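(* Let $n\ge 2$ and consider the Uniformed Patroller game on the star network $S_n$ ($n$ arcs) with attack duration $m=2$ and maximum delay $D\ge 2$. Then the following strategies are optimal. The Patroller reflects off the end nodes ($s=1$) and, when at the center, remains there with probability $$\hat r=\sqrt{n(n-1)}-(n-1),$$ i.e. he moves from the center to each given end with probability $\hat p=(1-\hat r)/n=1-\frac{\sqrt{n(n-1)}}{n}$. The Attacker locates at a uniformly random end node and begins her attack in the second consecutive period that the Patroller is away ($d=2$). The interception probability under these strategies, which is the value of the game, is $$V=(2n-1)-2\sqrt{n(n-1)}.$$
   Context: Star network: $S_n$ consists of a center $c$ joined by an edge to each of $n$ end nodes. Patroller strategies: time is discrete. A Patroller strategy is an irreducible Markov chain on the nodes, moving in each period along an edge or staying put, and invariant under all symmetries of the network. On $S_n$ such a strategy is given by parameters $(p,s)$ with $p\in(0,1/n]$, $s\in(0,1]$: from an end node he moves to the center with probability $s$ and stays with probability $1-s$; from the center he moves to each given end with probability $p$ and stays with probability $r=1-np$. "Reflecting at the ends" means $s=1$. Attacker strategies: a pure strategy is a pair $(i,d)$ with $i$ a node and $d$ an integer (the delay), $1\le d\le D$. The Attacker waits at node $i$ until the Patroller has visited $i$ and has then been away from $i$ for $d$ consecutive periods (the count resets to zero each time he returns to $i$). The attack at $i$ begins in the $d$-th such consecutive period of absence and occupies $m$ consecutive periods, the first being that period. The attack is intercepted if the Patroller is at $i$ in at least one of the $m$ periods. If the prescribed run of $d$ absences never occurs, there is no attack and the Attacker does not win (this counts as interception, payoff $1$). The Attacker may also randomize over pairs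 $(i,d)$. Payoff: the Patroller maximizes, and the Attacker minimizes, the probability of interception. The value of the game is the maximum over Patroller strategies of the minimum over Attacker strategies of the interception probability. A Patroller strategy is optimal if it guarantees interception probability at least $V$ against every Attacker strategy; an Attacker strategy is optimal if it guarantees interception probability at most $V$ against every Patroller strategy. *)

theory Defs
  imports "HOL-Probability.Probability"
begin

section \<open>Trajectories of a Markov chain\<close>

definition markov_step :: "'a pmf \<Rightarrow> ('a \<Rightarrow> 'a pmf) \<Rightarrow> nat \<Rightarrow> (nat \<Rightarrow> 'a) \<Rightarrow> 'a measure" where
  "markov_step \<mu> K t \<omega> = (case t of 0 \<Rightarrow> measure_pmf \<mu> | Suc u \<Rightarrow> measure_pmf (K (\<omega> u)))"

global_interpretation markov: Ionescu_Tulcea "markov_step \<mu> K" "\<lambda>_. count_space UNIV"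
  for \<mu> :: "'a pmf" and K :: "'a \<Rightarrow> 'a pmf"
proof (rule Ionescu_Tulcea.intro)
  fix i :: nat
  show "markov_step \<mu> K i \<in> measurable (PiM {0..<i} (\<lambda>_. count_space UNIV)) (subprob_algebra (count_space UNIV))"
  proof (cases i)
    case 0
    then show ?thesis
      by (simp add: markov_step_def[abs_def] measure_pmf_in_subprob_algebra)
  next
    case (Suc u)
    have "(\<lambda>\<omega>. \<omega> u) \<in> measurable (PiM {0..<i} (\<lambda>_. count_space UNIV)) (count_space (UNIV :: 'a set))"
      using Suc by (intro measurable_component_singleton) auto
    moreover have "(\<lambda>x. measure_pmf (K x)) \<in> measurable (count_space UNIV) (subprob_algebra (count_space UNIV))"
      by (simp add: measure_pmf_in_subprob_algebra)
    ultimately have "(\<lambda>\<omega>. measure_pmf (K (\<omega> u)))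
        \<in> measurable (PiM {0..<i} (\<lambda>_. count_space UNIV)) (subprob_algebra (count_space UNIV))"
      by (rule measurable_compose)
    then show ?thesis
      by (simp add: Suc markov_step_def[abs_def])
  qed
next
  fix i :: nat and x :: "nat \<Rightarrow> 'a"
  show "prob_space (markov_step \<mu> K i x)"
    by (auto simp: markov_step_def measure_pmf.prob_space_axioms split: nat.split)
qed

text \<open>The law, on infinite trajectories indexed by time, of the Markov chain with initial
  distribution \<open>\<mu>\<close> and transition kernel \<open>K\<close>.\<close>

definition chain_measure :: "'a pmf \<Rightarrow> ('a \<Rightarrow> 'a pmf) \<Rightarrow> (nat \<Rightarrow> 'a) measure" where
  "chain_measure \<mu> K = projective_family.lim UNIV (markov.CI \<mu> K) (\<lambda>_. count_space UNIV)"

lemma sets_chain_measure [measurable_cong]: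
  "sets (chain_measure \<mu> K) = sets (PiM UNIV (\<lambda>_. count_space UNIV))"
  unfolding chain_measure_def by simp

lemma space_chain_measure [simp]: "space (chain_measure \<mu> K) = UNIV"
  unfolding chain_measure_def by (simp add: space_PiM)


lemma singleton_sets_PiM_finite:
  assumes "finite J" "y \<in> extensional J"
  shows "{y} \<in> sets (PiM J (\<lambda>_. count_space UNIV))"
proof -
  have "{y} = PiE J (\<lambda>t. {y t})"
    using assms(2) by (auto simp: PiE_def Pi_def intro!: extensionalityI[of _ J])
  then show ?thesis
    using assms(1) by (auto intro!: sets_PiM_I_finite)
qed

lemma emeasure_markov_C_singleton:
  "emeasure (markov.C \<mu> K 0 N (\<lambda>_. undefined)) {restrict x {0..<N}} =
     (\<Prod>t<N. emeasure (markov_step \<mu> K t x) {x t})"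
proof (induction N)
  case 0
  have "{\<lambda>_. undefined} \<in> sets (PiM {0..<0::nat} (\<lambda>_. count_space (UNIV :: 'a set)))"
    by (rule singleton_sets_PiM_finite) auto
  then show ?case
    by (simp add: restrict_def)
next
  case (Suc N)
  let ?M = "\<lambda>n :: nat. PiM {0..<n} (\<lambda>_. count_space (UNIV :: 'a set))"
  let ?u = "\<lambda>_ :: nat. undefined :: 'a"
  let ?y = "restrict x {0..<N}" and ?y' = "restrict x {0..<Suc N}"
  have u: "?u \<in> space (?M 0)"
    by (simp add: space_PiM PiE_def)
  have y': "{?y'} \<in> sets (?M (Suc N))"
    by (rule singleton_sets_PiM_finite) auto
  have y: "{?y} \<in> sets (?M N)"
    by (rule singleton_sets_PiM_finite) auto
  have step: "emeasure (markov.eP \<mu> K N \<omega>) {?y'} =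
      emeasure (markov_step \<mu> K N x) {x N} * indicator {?y} \<omega>"
    if \<omega>: "\<omega> \<in> space (?M N)" for \<omega>
  proof -
    have ext: "\<omega> \<in> extensional {0..<N}"
      using \<omega> by (auto simp: space_PiM PiE_def)
    have "emeasure (markov.eP \<mu> K N \<omega>) {?y'} =
        emeasure (markov_step \<mu> K N \<omega>) ((\<lambda>z. fun_upd \<omega> N z) -` {?y'})"
      using markov.emeasure_eP[OF \<omega> y'] by simp
    also have "\<dots> = emeasure (markov_step \<mu> K N x) {x N} * indicator {?y} \<omega>"
    proof (cases "\<omega> = ?y")
      case True
      have "(\<lambda>z. fun_upd \<omega> N z) -` {?y'} = {x N}"
        using True by (auto simp: fun_eq_iff restrict_def less_Suc_eq split: if_splits dest: spec[of _ N])
      moreover have "markov_step \<mu> K N \<omega> = markov_step \<mu> K N x"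
        using True by (auto simp: markov_step_def split: nat.split)
      ultimately show ?thesis
        using True by simp
    next
      case False
      then obtain t where t: "\<omega> t \<noteq> ?y t" by (auto simp del: restrict_apply)
      with ext have "t < N"
        by (cases "t < N") (auto simp: extensional_def)
      then have "(fun_upd \<omega> N z) t \<noteq> ?y' t" for z
        using t by simp
      then have "(\<lambda>z. fun_upd \<omega> N z) -` {?y'} = {}"
        by (metis (mono_tags, lifting) empty_iff singletonD subsetI subset_antisym vimage_eq)
      then show ?thesis
        using False by simp
    qed
    finally show ?thesis .
  qed
  have sp: "space (markov.C \<mu> K 0 N ?u) = space (?M N)"
    using markov.space_C[OF u, of \<mu> K N] by simp
  have st: "sets (markov.C \<mu> K 0 N ?u) = sets (?M N)"
    using markov.sets_C[OF u, of \<mu> K N] by simp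
  have ne: "space (markov.C \<mu> K 0 N ?u) \<noteq> {}"
    unfolding sp by (simp add: space_PiM PiE_eq_empty_iff)
  have "emeasure (markov.C \<mu> K 0 (Suc N) ?u) {?y'} =
      (\<integral>\<^sup>+\<omega>. emeasure (markov.eP \<mu> K N \<omega>) {?y'} \<partial>markov.C \<mu> K 0 N ?u)"
    using emeasure_bind[OF ne _ y', of "markov.eP \<mu> K N"] markov.measurable_eP[of \<mu> K N]
    by (simp add: measurable_cong_sets[OF st refl])
  also have "\<dots> = (\<integral>\<^sup>+\<omega>. emeasure (markov_step \<mu> K N x) {x N} * indicator {?y} \<omega> \<partial>markov.C \<mu> K 0 N ?u)"
    by (intro nn_integral_cong) (simp add: step sp)
  also have "\<dots> = emeasure (markov_step \<mu> K N x) {x N} * emeasure (markov.C \<mu> K 0 N ?u) {?y}"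
    using y by (subst nn_integral_cmult_indicator) (auto simp: st)
  finally show ?case
    by (simp add: Suc.IH mult.commute del: restrict_apply)
qed

lemma emeasure_chain_measure_cylinder:
  "emeasure (chain_measure \<mu> K) {\<omega>. \<forall>t\<le>N. \<omega> t = x t} =
     (\<Prod>t<Suc N. emeasure (markov_step \<mu> K t x) {x t})"
proof -
  let ?y = "restrict x {0..<Suc N}"
  have sets: "{?y} \<in> sets (PiM {0..<Suc N} (\<lambda>_. count_space UNIV))"
    by (rule singleton_sets_PiM_finite) auto
  have emb: "{\<omega>. \<forall>t\<le>N. \<omega> t = x t} = markov.PF.emb UNIV {0..<Suc N} {?y}"
    by (auto simp: prod_emb_def restrict_def fun_eq_iff less_Suc_eq_le split: if_splits)
  have emb': "markov.PF.emb {0..<Suc N} {0..<Suc N} {?y} = {?y}"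
    by (rule prod_emb_id) (auto simp: space_PiM)
  show ?thesis
    unfolding emb chain_measure_def
    using markov.lim[OF _ sets, of \<mu> K] markov.emeasure_CI[OF subset_refl sets, of \<mu> K]
    by (simp only: finite_atLeastLessThan emb' emeasure_markov_C_singleton simp_thms)
qed

lemma measure_chain_measure_cylinder:
  "measure (chain_measure \<mu> K) {\<omega>. \<forall>t\<le>N. \<omega> t = x t} =
     pmf \<mu> (x 0) * (\<Prod>t<N. pmf (K (x t)) (x (Suc t)))"
proof -
  have "emeasure (chain_measure \<mu> K) {\<omega>. \<forall>t\<le>N. \<omega> t = x t} =
      ennreal (pmf \<mu> (x 0) * (\<Prod>t<N. pmf (K (x t)) (x (Suc t))))"
    unfolding emeasure_chain_measure_cylinder prod.lessThan_Suc_shift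
    by (simp add: markov_step_def emeasure_pmf_single prod_ennreal ennreal_mult prod_nonneg)
  then show ?thesis
    by (simp add: measure_def prod_nonneg)
qed

lemma prob_space_chain_measure: "prob_space (chain_measure \<mu> K)"
proof
  have "emeasure (markov.PF.lim \<mu> K) (markov.PF.emb UNIV {} {\<lambda>_. undefined}) = 1"
    using markov.lim[of "{}" "{\<lambda>_. undefined}" \<mu> K]
      markov.emeasure_CI[of "{}" 0 "{\<lambda>_. undefined}" \<mu> K]
    by (simp add: PiM_empty prod_emb_def)
  moreover have "markov.PF.emb UNIV {} {\<lambda>_. undefined :: 'a} = UNIV"
    by (auto simp: prod_emb_def)
  ultimately show "emeasure (chain_measure \<mu> K) (space (chain_measure \<mu> K)) = 1"
    by (simp add: chain_measure_def space_PiM)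
qed

section \<open>The uniformed patroller game on a network\<close>

text \<open>A network is given by its set of nodes \<open>V\<close> and its adjacency relation \<open>E\<close>. Transition
  kernels are total functions on the node type; only their restriction to \<open>V\<close> matters.\<close>

definition network_symmetries :: "'a set \<Rightarrow> ('a \<Rightarrow> 'a \<Rightarrow> bool) \<Rightarrow> ('a \<Rightarrow> 'a) set" where
  "network_symmetries V E = {f. bij_betw f V V \<and> (\<forall>x\<in>V. \<forall>y\<in>V. E (f x) (f y) \<longleftrightarrow> E x y)}"

definition irreducible_on :: "'a set \<Rightarrow> ('a \<Rightarrow> 'a pmf) \<Rightarrow> bool" where
  "irreducible_on V K \<longleftrightarrow> (\<forall>x\<in>V. \<forall>y\<in>V. (x, y) \<in> {(a, b). a \<in> V \<and> b \<in> set_pmf (K a)}\<^sup>*)"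

definition patroller_strategies :: "'a set \<Rightarrow> ('a \<Rightarrow> 'a \<Rightarrow> bool) \<Rightarrow> ('a \<Rightarrow> 'a pmf) set" where
  "patroller_strategies V E = {K.
     (\<forall>x\<in>V. \<forall>y\<in>set_pmf (K x). y \<in> V \<and> (y = x \<or> E x y)) \<and>
     irreducible_on V K \<and>
     (\<forall>f\<in>network_symmetries V E. \<forall>x\<in>V. \<forall>y\<in>V. pmf (K (f x)) (f y) = pmf (K x) y)}"

text \<open>Mixed strategies of the Attacker; a pure strategy \<open>(i, d)\<close> is \<open>return_pmf (i, d)\<close>.\<close>

definition attacker_strategies :: "'a set \<Rightarrow> nat \<Rightarrow> ('a \<times> nat) pmf set" where
  "attacker_strategies V D = {A. set_pmf A \<subseteq> V \<times> {1..D}}"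

text \<open>In \<open>absent_run i d \<omega> t\<close>, period \<open>t\<close> is the \<open>d\<close>-th consecutive period of absence from \<open>i\<close>
  counted from a visit to \<open>i\<close>, which takes place in period \<open>t - d\<close>. The attack begins at the
  first such \<open>t\<close>.\<close>

definition absent_run :: "'a \<Rightarrow> nat \<Rightarrow> (nat \<Rightarrow> 'a) \<Rightarrow> nat \<Rightarrow> bool" where
  "absent_run i d \<omega> t \<longleftrightarrow> d \<le> t \<and> \<omega> (t - d) = i \<and> (\<forall>u\<in>{t - d<..t}. \<omega> u \<noteq> i)"

definition intercepted :: "nat \<Rightarrow> 'a \<Rightarrow> nat \<Rightarrow> (nat \<Rightarrow> 'a) \<Rightarrow> bool" where
  "intercepted m i d \<omega> \<longleftrightarrow>
     (\<forall>t. \<not> absent_run i d \<omega> t) \<or>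
     (\<exists>u\<in>{(LEAST t. absent_run i d \<omega> t)..<(LEAST t. absent_run i d \<omega> t) + m}. \<omega> u = i)"

text \<open>\<open>\<mu>\<close> is the distribution of the Patroller's initial position. The rules of the game leave it
  unspecified: the Attacker first waits for a visit to \<open>i\<close>, so it is irrelevant for an irreducible
  chain.\<close>

definition interception_prob :: "nat \<Rightarrow> 'a pmf \<Rightarrow> ('a \<Rightarrow> 'a pmf) \<Rightarrow> 'a \<Rightarrow> nat \<Rightarrow> real" where
  "interception_prob m \<mu> K i d = measure (chain_measure \<mu> K) {\<omega>. intercepted m i d \<omega>}"

definition payoff :: "nat \<Rightarrow> 'a pmf \<Rightarrow> ('a \<Rightarrow> 'a pmf) \<Rightarrow> ('a \<times> nat) pmf \<Rightarrow> real" where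
  "payoff m \<mu> K A = measure_pmf.expectation A (\<lambda>(i, d). interception_prob m \<mu> K i d)"

text \<open>The infimum is a minimum, since for finite \<open>V\<close> the payoff is an average over finitely many
  pure strategies; the supremum is a maximum as soon as an optimal Patroller strategy exists.\<close>

definition game_value :: "'a set \<Rightarrow> ('a \<Rightarrow> 'a \<Rightarrow> bool) \<Rightarrow> nat \<Rightarrow> nat \<Rightarrow> 'a pmf \<Rightarrow> real" where
  "game_value V E m D \<mu> =
     (SUP K\<in>patroller_strategies V E. INF A\<in>attacker_strategies V D. payoff m \<mu> K A)"

definition patroller_optimal ::
    "'a set \<Rightarrow> ('a \<Rightarrow> 'a \<Rightarrow> bool) \<Rightarrow> nat \<Rightarrow> nat \<Rightarrow> 'a pmf \<Rightarrow> ('a \<Rightarrow> 'a pmf) \<Rightarrow> bool" where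
  "patroller_optimal V E m D \<mu> K \<longleftrightarrow> K \<in> patroller_strategies V E \<and>
     (\<forall>A\<in>attacker_strategies V D. game_value V E m D \<mu> \<le> payoff m \<mu> K A)"

definition attacker_optimal ::
    "'a set \<Rightarrow> ('a \<Rightarrow> 'a \<Rightarrow> bool) \<Rightarrow> nat \<Rightarrow> nat \<Rightarrow> 'a pmf \<Rightarrow> ('a \<times> nat) pmf \<Rightarrow> bool" where
  "attacker_optimal V E m D \<mu> A \<longleftrightarrow> A \<in> attacker_strategies V D \<and>
     (\<forall>K\<in>patroller_strategies V E. payoff m \<mu> K A \<le> game_value V E m D \<mu>)"

section \<open>The star network\<close>

datatype star_node = Center | End nat

definition star_nodes :: "nat \<Rightarrow> star_node set" where
  "star_nodes n = insert Center (End ` {1..n})"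

definition star_edge :: "nat \<Rightarrow> star_node \<Rightarrow> star_node \<Rightarrow> bool" where
  "star_edge n x y \<longleftrightarrow>
     (x = Center \<and> y \<in> End ` {1..n}) \<or> (x \<in> End ` {1..n} \<and> y = Center)"

text \<open>The kernel with parameters \<open>(p, s)\<close>, intended for \<open>0 < p \<le> 1 / n\<close> and \<open>0 < s \<le> 1\<close>: the
  center is left with probability \<open>n p\<close>, for a uniformly random end. Its transition probabilities
  are \<open>pmf_star_chain\<close> below.\<close>

fun star_chain :: "nat \<Rightarrow> real \<Rightarrow> real \<Rightarrow> star_node \<Rightarrow> star_node pmf" where
  "star_chain n p s Center =
     bernoulli_pmf (real n * p) \<bind>
       (\<lambda>b. if b then map_pmf End (pmf_of_set {1..n}) else return_pmf Center)"
| "star_chain n p s (End j) = map_pmf (\<lambda>b. if b then Center else End j) (bernoulli_pmf s)"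

lemma pmf_star_chain:
  assumes "n \<ge> 1" "0 \<le> p" "p \<le> 1 / real n" "0 \<le> s" "s \<le> 1"
  shows "j \<in> {1..n} \<Longrightarrow> pmf (star_chain n p s Center) (End j) = p"
    and "pmf (star_chain n p s Center) Center = 1 - real n * p"
    and "pmf (star_chain n p s (End j)) Center = s"
    and "pmf (star_chain n p s (End j)) (End j) = 1 - s"
proof -
  have np: "0 \<le> real n * p" "real n * p \<le> 1"
    using assms by (auto simp: field_simps)
  have inj: "inj End"
    by (auto intro: injI)
  have c: "pmf (map_pmf End (pmf_of_set {1..n})) Center = 0"
    by (auto simp: pmf_eq_0_set_pmf)
  show "pmf (star_chain n p s Center) (End j) = p" if "j \<in> {1..n}"
    using np that assms(1) pmf_map_inj'[OF inj, of "pmf_of_set {1..n}" j]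
    by (simp add: pmf_bind)
  show "pmf (star_chain n p s Center) Center = 1 - real n * p"
    using np c by (simp add: pmf_bind)
  have "(\<lambda>b. if b then Center else End j) -` {Center} = {True}"
    "(\<lambda>b. if b then Center else End j) -` {End j} = {False}"
    by (auto split: if_splits)
  then show "pmf (star_chain n p s (End j)) Center = s"
    and "pmf (star_chain n p s (End j)) (End j) = 1 - s"
    using assms(4,5) by (simp_all add: pmf_map measure_pmf_single)
qed

definition uniform_end_attack :: "nat \<Rightarrow> nat \<Rightarrow> (star_node \<times> nat) pmf" where
  "uniform_end_attack n d = map_pmf (\<lambda>j. (End j, d)) (pmf_of_set {1..n})"

end

theory Submission
  imports Defs
begin

text \<open>
  Write \<open>p\<close> for the probability of moving from the center to a given end, \<open>r = 1 - n p\<close> for that of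
  staying at the center, and call \<open>d\<close> consecutive absences after a visit a run. Since \<open>m = 2\<close>, an
  attack that begins in period \<open>t\<close> is intercepted exactly when the Patroller is at the attacked node
  in period \<open>t + 1\<close>.

  \<^emph>\<open>The Attacker.\<close> Let her attack an end with \<open>d = 2\<close>. In the first period of absence the Patroller is
  at the center, the only way out. In the second he is still absent with probability \<open>1 - p\<close>, and
  still at the center with probability \<open>r\<close>; only from the center can he return in time, with
  probability \<open>p\<close>. Hence every Patroller strategy, whatever its \<open>s\<close>, intercepts with probability
  \<open>\<phi> p = p (1 - n p) / (1 - p)\<close> (\<open>interception_prob_end_2\<close>). This needs the run to occur almost
  surely, which holds because from every position a run is completed within four periods with a
  probability bounded away from zero (\<open>P_never_run_2\<close>). The quadratic \<open>V (1 - p) - p (1 - n p)\<close> has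
  discriminant zero for the claimed \<open>V\<close>, so \<open>\<phi> p \<le> V\<close>, with equality at the claimed \<open>p\<close>.

  \<^emph>\<open>The Patroller.\<close> Let him reflect at the ends. An attack at the center always fails: he is back
  after one period. For an attack at an end, consider the period before the run is complete, and let
  \<open>a\<close> and \<open>b\<close> be the probabilities that he is then at the center or elsewhere. The run is completed
  with probability \<open>(1 - p) a + b\<close>, and with him at the center with probability \<open>r a + b\<close>. As
  \<open>r \<le> 1 - p\<close>, the ratio is least when \<open>b = 0\<close>, and the interception probability is at least
  \<open>p r / (1 - p) = \<phi> p\<close> for every delay (\<open>interception_prob_end_reflecting\<close>): the delay \<open>d = 2\<close> is
  the Attacker's best response.

  The two bounds make the pair of strategies a saddle point (\<open>saddle_point\<close>).
\<close>

section \<open>The Markov property\<close>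

text \<open>Nodes are made countable so that every event decided by finitely many periods is a countable
  union of cylinders.\<close>

instance star_node :: countable
  by countable_datatype

definition determined_upto :: "nat \<Rightarrow> ((nat \<Rightarrow> 'a) \<Rightarrow> bool) \<Rightarrow> bool" where
  "determined_upto t P \<longleftrightarrow> (\<forall>\<omega> \<omega>'. (\<forall>u\<le>t. \<omega> u = \<omega>' u) \<longrightarrow> P \<omega> = P \<omega>')"

lemma determined_upto_coordinate:
  "u \<le> t \<Longrightarrow> determined_upto t (\<lambda>\<omega>. \<omega> u = x)"
  "u \<le> t \<Longrightarrow> determined_upto t (\<lambda>\<omega>. \<omega> u \<in> Y)"
  by (simp_all add: determined_upto_def)

lemma determined_upto_conj:
  "determined_upto t P \<Longrightarrow> determined_upto t Q \<Longrightarrow> determined_upto t (\<lambda>\<omega>. P \<omega> \<and> Q \<omega>)"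
  unfolding determined_upto_def by metis

lemma determined_upto_not: "determined_upto t P \<Longrightarrow> determined_upto t (\<lambda>\<omega>. \<not> P \<omega>)"
  unfolding determined_upto_def by metis

lemma determined_upto_all:
  "(\<And>x. x \<in> X \<Longrightarrow> determined_upto t (P x)) \<Longrightarrow> determined_upto t (\<lambda>\<omega>. \<forall>x\<in>X. P x \<omega>)"
  unfolding determined_upto_def by metis

lemma determined_upto_mono: "determined_upto t P \<Longrightarrow> t \<le> u \<Longrightarrow> determined_upto u P"
  unfolding determined_upto_def using le_trans[of _ t u] by simp

lemma determined_upto_absent_run: "t \<le> u \<Longrightarrow> determined_upto u (\<lambda>\<omega>. absent_run i d \<omega> t)"
  unfolding determined_upto_def absent_run_def by simp

lemmas determined_upto_intros =
  determined_upto_coordinate determined_upto_conj determined_upto_not determined_upto_all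
  determined_upto_absent_run

lemma measurable_coordinate [measurable]:
  "(\<lambda>\<omega>. \<omega> t) \<in> measurable (chain_measure \<mu> K) (count_space UNIV)"
  by measurable

lemma sets_determined_upto:
  fixes P :: "(nat \<Rightarrow> 'a::countable) \<Rightarrow> bool"
  assumes "determined_upto t P"
  shows "{\<omega>. P \<omega>} \<in> sets (chain_measure \<mu> K)"
proof -
  let ?f = "\<lambda>\<omega> :: nat \<Rightarrow> 'a. map \<omega> [0..<Suc t]"
  let ?X = "\<lambda>l. {\<omega>. \<forall>u\<in>{..t}. \<omega> u = l ! u}"
  have X_sets: "?X l \<in> sets (chain_measure \<mu> K)" for l :: "'a list"
  proof -
    have "{\<omega> \<in> space (chain_measure \<mu> K). \<forall>u\<in>{..t}. \<omega> u = l ! u} \<in> sets (chain_measure \<mu> K)"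
      by measurable
    then show ?thesis by simp
  qed
  have "{\<omega>. P \<omega>} = (\<Union>l \<in> ?f ` {\<omega>. P \<omega>}. ?X l)"
  proof -
    have nth: "?f \<omega> ! u = \<omega> u" if "u \<le> t" for \<omega> u
      using that by (simp del: upt_Suc)
    have "P \<omega>" if "P \<omega>'" "\<omega> \<in> ?X (?f \<omega>')" for \<omega> \<omega>'
    proof -
      have "\<forall>u\<le>t. \<omega> u = \<omega>' u" using that(2) nth by simp
      then show ?thesis using assms that(1) unfolding determined_upto_def by blast
    qed
    moreover have "\<omega> \<in> ?X (?f \<omega>)" for \<omega>
      using nth by simp
    ultimately show ?thesis by blast
  qed
  then show ?thesis
    by (rule ssubst) (intro sets.countable_UN'' countableI_type X_sets)
qed

text \<open>The event is a countable disjoint union of cylinders, and lengthening a cylinder by one period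
  multiplies its probability by one transition probability.\<close>

lemma markov_property_point:
  fixes \<mu> :: "'a::countable pmf"
  assumes "determined_upto t P"
  shows "emeasure (chain_measure \<mu> K) {\<omega>. P \<omega> \<and> \<omega> t = x \<and> \<omega> (Suc t) = y} =
    pmf (K x) y * emeasure (chain_measure \<mu> K) {\<omega>. P \<omega> \<and> \<omega> t = x}"
proof -
  let ?M = "chain_measure \<mu> K"
  interpret prob_space ?M by (rule prob_space_chain_measure)
  let ?f = "\<lambda>\<omega> :: nat \<Rightarrow> 'a. map \<omega> [0..<Suc t]"
  define L where "L = ?f ` {\<omega>. P \<omega> \<and> \<omega> t = x}"
  define X where "X l = {\<omega>. ?f \<omega> = l}" for l
  define Y where "Y l = {\<omega>. ?f \<omega> = l \<and> \<omega> (Suc t) = y}" for l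
  have f_eq: "?f \<omega> = ?f \<omega>' \<longleftrightarrow> (\<forall>u\<le>t. \<omega> u = \<omega>' u)" for \<omega> \<omega>'
    by (auto simp del: upt_Suc simp: less_Suc_eq_le)
  have P_cong: "P \<omega> \<longleftrightarrow> P \<omega>'" "\<omega> t = \<omega>' t" if "?f \<omega> = ?f \<omega>'" for \<omega> \<omega>'
    using that assms unfolding f_eq determined_upto_def by auto
  have "determined_upto t (\<lambda>\<omega>. ?f \<omega> = l)" for l
    unfolding determined_upto_def f_eq[symmetric] by metis
  then have X_sets: "X l \<in> sets ?M" for l
    unfolding X_def by (rule sets_determined_upto)
  have "determined_upto (Suc t) (\<lambda>\<omega>. ?f \<omega> = l \<and> \<omega> (Suc t) = y)" for l
    unfolding determined_upto_def by (simp del: upt_Suc) (metis f_eq le_SucI order_refl)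
  then have Y_sets: "Y l \<in> sets ?M" for l
    unfolding Y_def by (rule sets_determined_upto)
  have "emeasure ?M (Y l) = pmf (K x) y * emeasure ?M (X l)" if "l \<in> L" for l
  proof -
    obtain \<omega> where \<omega>: "l = ?f \<omega>" "\<omega> t = x"
      using \<open>l \<in> L\<close> unfolding L_def by blast
    define \<omega>' where "\<omega>' = fun_upd \<omega> (Suc t) y"
    have "X l = {\<eta>. \<forall>u\<le>t. \<eta> u = \<omega> u}"
      unfolding X_def \<omega>(1) f_eq ..
    moreover have "Y l = {\<eta>. \<forall>u\<le>Suc t. \<eta> u = \<omega>' u}"
      unfolding Y_def \<omega>(1) f_eq \<omega>'_def by (auto simp: le_Suc_eq)
    moreover have "(\<Prod>u<t. pmf (K (\<omega>' u)) (\<omega>' (Suc u))) = (\<Prod>u<t. pmf (K (\<omega> u)) (\<omega> (Suc u)))"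
      by (rule prod.cong) (auto simp: \<omega>'_def)
    ultimately have "measure ?M (Y l) = pmf (K x) y * measure ?M (X l)"
      by (simp add: measure_chain_measure_cylinder \<omega>(2)) (simp add: \<omega>'_def \<omega>(2))
    then show ?thesis
      by (simp add: emeasure_eq_measure ennreal_mult')
  qed
  moreover have "{\<omega>. P \<omega> \<and> \<omega> t = x} = (\<Union>l\<in>L. X l)"
    unfolding L_def X_def using P_cong by blast
  moreover have "{\<omega>. P \<omega> \<and> \<omega> t = x \<and> \<omega> (Suc t) = y} = (\<Union>l\<in>L. Y l)"
    unfolding L_def Y_def using P_cong by blast
  moreover have "disjoint_family_on X L" "disjoint_family_on Y L"
    unfolding X_def Y_def disjoint_family_on_def by auto
  moreover have "countable L" by simp
  ultimately show ?thesis
    using X_sets Y_sets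
    by (simp add: emeasure_UN_countable nn_integral_cmult[symmetric] cong: nn_integral_cong_simp)
qed

lemma AE_chain_support:
  fixes \<mu> :: "'a::countable pmf"
  shows "AE \<omega> in chain_measure \<mu> K. \<omega> 0 \<in> set_pmf \<mu> \<and> (\<forall>t. \<omega> (Suc t) \<in> set_pmf (K (\<omega> t)))"
proof -
  let ?M = "chain_measure \<mu> K"
  interpret prob_space ?M by (rule prob_space_chain_measure)
  have start: "AE \<omega> in ?M. \<omega> 0 = x \<longrightarrow> x \<in> set_pmf \<mu>" for x
  proof (cases "x \<in> set_pmf \<mu>")
    case False
    then have "emeasure ?M {\<omega>. \<omega> 0 = x} = 0"
      using measure_chain_measure_cylinder[of \<mu> K 0 "\<lambda>_. x"]
      by (simp add: emeasure_eq_measure set_pmf_iff)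
    moreover have "{\<omega>. \<omega> 0 = x} \<in> sets ?M"
      by (rule sets_determined_upto) (rule determined_upto_coordinate, simp)
    ultimately have "AE \<omega> in ?M. \<omega> 0 \<noteq> x"
      by (intro AE_I[of _ _ "{\<omega>. \<omega> 0 = x}"]) auto
    then show ?thesis by eventually_elim simp
  qed simp
  have move: "AE \<omega> in ?M. \<omega> t = x \<and> \<omega> (Suc t) = y \<longrightarrow> y \<in> set_pmf (K x)" for t x y
  proof (cases "y \<in> set_pmf (K x)")
    case False
    then have "emeasure ?M {\<omega>. \<omega> t = x \<and> \<omega> (Suc t) = y} = 0"
      using markov_property_point[of t "\<lambda>_. True" \<mu> K x y]
      by (simp add: determined_upto_def set_pmf_iff)
    moreover have "{\<omega>. \<omega> t = x \<and> \<omega> (Suc t) = y} \<in> sets ?M"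
      by (rule sets_determined_upto[of "Suc t"]) (auto intro!: determined_upto_intros)
    ultimately have "AE \<omega> in ?M. \<not> (\<omega> t = x \<and> \<omega> (Suc t) = y)"
      by (intro AE_I[of _ _ "{\<omega>. \<omega> t = x \<and> \<omega> (Suc t) = y}"]) auto
    then show ?thesis by eventually_elim blast
  qed simp
  have "AE \<omega> in ?M. \<forall>x. \<omega> 0 = x \<longrightarrow> x \<in> set_pmf \<mu>"
    using start unfolding AE_all_countable by blast
  moreover have "AE \<omega> in ?M. \<forall>t x y. \<omega> t = x \<and> \<omega> (Suc t) = y \<longrightarrow> y \<in> set_pmf (K x)"
    using move unfolding AE_all_countable by blast
  ultimately show ?thesis by eventually_elim auto
qed

text \<open>The one-step rule on which all probability computations below rest. The transition probability
  need only be constant at the positions compatible with \<open>P\<close> inside a set \<open>S\<close> that the chain cannot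
  leave, so different positions can be treated together.\<close>

lemma markov_property:
  fixes \<mu> :: "'a::countable pmf"
  assumes det: "determined_upto t P"
    and start: "set_pmf \<mu> \<subseteq> S" and closed: "\<And>x. x \<in> S \<Longrightarrow> set_pmf (K x) \<subseteq> S"
    and q: "\<And>\<omega>. P \<omega> \<Longrightarrow> \<omega> t \<in> S \<Longrightarrow> measure_pmf.prob (K (\<omega> t)) Y = q"
  shows "measure (chain_measure \<mu> K) {\<omega>. P \<omega> \<and> \<omega> (Suc t) \<in> Y} =
    q * measure (chain_measure \<mu> K) {\<omega>. P \<omega>}"
proof (cases "\<exists>\<omega>. P \<omega> \<and> \<omega> t \<in> S")
  let ?M = "chain_measure \<mu> K"
  have in_S: "AE \<omega> in ?M. \<omega> t \<in> S"
    using AE_chain_support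
  proof eventually_elim
    case (elim \<omega>)
    then show ?case
      using start closed by (induction t) auto
  qed
  have sets: "{\<omega>. P \<omega>} \<in> sets ?M" "{\<omega>. P \<omega> \<and> \<omega> (Suc t) \<in> Y} \<in> sets ?M"
    using det
    by (auto intro!: sets_determined_upto[of "Suc t"] determined_upto_intros
        determined_upto_mono[OF det])
  {
    case False
    have "AE \<omega> in ?M. \<not> P \<omega>"
      using in_S False by auto
    then have "measure ?M {\<omega>. P \<omega>} = 0" "measure ?M {\<omega>. P \<omega> \<and> \<omega> (Suc t) \<in> Y} = 0"
      by (auto intro!: measure_eq_0_null_sets AE_iff_null_sets[THEN iffD2] simp: sets elim: eventually_mono)
    then show ?thesis by simp
  next
    case True
    then have "q \<ge> 0" using q by (metis measure_nonneg)
    interpret prob_space ?M by (rule prob_space_chain_measure)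
    have [simp]: "{\<omega>. P \<omega> \<and> \<omega> t = x} \<in> sets ?M" for x
      using det by (auto intro!: sets_determined_upto[of t] determined_upto_intros)
    have [simp]: "{\<omega>. P \<omega> \<and> \<omega> t = x \<and> \<omega> (Suc t) = y} \<in> sets ?M" for x y
      using det by (auto intro!: sets_determined_upto[of "Suc t"] determined_upto_intros
        determined_upto_mono[OF det])
    have [simp]: "{\<omega>. P \<omega> \<and> \<omega> t = x \<and> \<omega> (Suc t) \<in> Y} \<in> sets ?M" for x
      using det by (auto intro!: sets_determined_upto[of "Suc t"] determined_upto_intros
        determined_upto_mono[OF det])
    have point: "emeasure ?M {\<omega>. P \<omega> \<and> \<omega> t = x \<and> \<omega> (Suc t) \<in> Y} =
        q * emeasure ?M {\<omega>. P \<omega> \<and> \<omega> t = x}" for x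
    proof -
      have "{\<omega>. P \<omega> \<and> \<omega> t = x \<and> \<omega> (Suc t) \<in> Y} = (\<Union>y\<in>Y. {\<omega>. P \<omega> \<and> \<omega> t = x \<and> \<omega> (Suc t) = y})"
        by auto
      then have "emeasure ?M {\<omega>. P \<omega> \<and> \<omega> t = x \<and> \<omega> (Suc t) \<in> Y} =
          (\<integral>\<^sup>+y. emeasure ?M {\<omega>. P \<omega> \<and> \<omega> t = x \<and> \<omega> (Suc t) = y} \<partial>count_space Y)"
        by (simp only:) (subst emeasure_UN_countable, auto simp: disjoint_family_on_def)
      also have "\<dots> = emeasure (measure_pmf (K x)) Y * emeasure ?M {\<omega>. P \<omega> \<and> \<omega> t = x}"
        by (simp add: markov_property_point[OF det] nn_integral_multc nn_integral_pmf)
      also have "\<dots> = q * emeasure ?M {\<omega>. P \<omega> \<and> \<omega> t = x}"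
      proof (cases "\<exists>\<omega>. P \<omega> \<and> \<omega> t = x \<and> x \<in> S")
        case True
        then show ?thesis using q by (auto simp: measure_pmf.emeasure_eq_measure)
      next
        case False
        then have "AE \<omega> in ?M. \<omega> \<notin> {\<omega>. P \<omega> \<and> \<omega> t = x}"
          using in_S by auto
        then have "emeasure ?M {\<omega>. P \<omega> \<and> \<omega> t = x} = 0"
          using AE_iff_measurable[of "{\<omega>. P \<omega> \<and> \<omega> t = x}" ?M] by simp
        then show ?thesis by simp
      qed
      finally show ?thesis .
    qed
    have "{\<omega>. P \<omega> \<and> \<omega> (Suc t) \<in> Y} = (\<Union>x. {\<omega>. P \<omega> \<and> \<omega> t = x \<and> \<omega> (Suc t) \<in> Y})"
      by auto
    then have "emeasure ?M {\<omega>. P \<omega> \<and> \<omega> (Suc t) \<in> Y} =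
        (\<integral>\<^sup>+x. emeasure ?M {\<omega>. P \<omega> \<and> \<omega> t = x \<and> \<omega> (Suc t) \<in> Y} \<partial>count_space UNIV)"
      by (simp only:) (subst emeasure_UN_countable, auto simp: disjoint_family_on_def)
    also have "\<dots> = q * (\<integral>\<^sup>+x. emeasure ?M {\<omega>. P \<omega> \<and> \<omega> t = x} \<partial>count_space UNIV)"
      by (simp add: point nn_integral_cmult)
    also have "(\<integral>\<^sup>+x. emeasure ?M {\<omega>. P \<omega> \<and> \<omega> t = x} \<partial>count_space UNIV) =
        emeasure ?M (\<Union>x. {\<omega>. P \<omega> \<and> \<omega> t = x})"
      by (subst emeasure_UN_countable, auto simp: disjoint_family_on_def)
    also have "(\<Union>x. {\<omega>. P \<omega> \<and> \<omega> t = x}) = {\<omega>. P \<omega>}"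
      by auto
    finally show ?thesis
      using \<open>q \<ge> 0\<close> by (simp add: emeasure_eq_measure ennreal_mult'[symmetric])
  }
qed


section \<open>Interception of attacks of duration two\<close>

lemma absent_run_0: "absent_run i 0 \<omega> t \<longleftrightarrow> \<omega> t = i"
  by (simp add: absent_run_def)

lemma absent_run_Suc:
  "absent_run i (Suc d) \<omega> (Suc t) \<longleftrightarrow> absent_run i d \<omega> t \<and> \<omega> (Suc t) \<noteq> i"
proof (cases "d \<le> t")
  case True
  then have "{Suc t - Suc d<..Suc t} = insert (Suc t) {t - d<..t}" by auto
  then show ?thesis by (auto simp: absent_run_def)
qed (simp add: absent_run_def)

lemma not_absent_run_Suc_0: "\<not> absent_run i (Suc d) \<omega> 0"
  by (simp add: absent_run_def)

definition first_run :: "'a \<Rightarrow> nat \<Rightarrow> (nat \<Rightarrow> 'a) \<Rightarrow> nat \<Rightarrow> bool" where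
  "first_run i d \<omega> t \<longleftrightarrow> absent_run i d \<omega> t \<and> (\<forall>t'\<in>{..<t}. \<not> absent_run i d \<omega> t')"

lemma first_run_unique: "first_run i d \<omega> t \<Longrightarrow> first_run i d \<omega> t' \<Longrightarrow> t = t'"
  unfolding first_run_def by (metis lessThan_iff linorder_neqE_nat)

lemma first_run_iff_Least:
  assumes "absent_run i d \<omega> u"
  shows "first_run i d \<omega> t \<longleftrightarrow> t = (LEAST t. absent_run i d \<omega> t)"
proof -
  have "first_run i d \<omega> (LEAST t. absent_run i d \<omega> t)"
    unfolding first_run_def using LeastI[of "absent_run i d \<omega>", OF assms] not_less_Least by auto
  then show ?thesis using first_run_unique by metis
qed

lemma intercepted_2_iff:
  assumes "d \<ge> 1"
  shows "intercepted 2 i d \<omega> \<longleftrightarrow>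
    (\<forall>t. \<not> absent_run i d \<omega> t) \<or> (\<exists>t. first_run i d \<omega> t \<and> \<omega> (Suc t) = i)"
proof (cases "\<exists>t. absent_run i d \<omega> t")
  case True
  then obtain u where u: "absent_run i d \<omega> u" ..
  define T where "T = (LEAST t. absent_run i d \<omega> t)"
  have "absent_run i d \<omega> T"
    unfolding T_def using u by (rule LeastI)
  then have "\<omega> T \<noteq> i"
    using assms by (auto simp: absent_run_def)
  moreover have "{T..<T + 2} = {T, Suc T}" by auto
  ultimately show ?thesis
    using u by (auto simp: intercepted_def first_run_iff_Least[OF u] simp flip: T_def)
qed (simp add: intercepted_def)

lemma determined_upto_first_run: "t \<le> u \<Longrightarrow> determined_upto u (\<lambda>\<omega>. first_run i d \<omega> t)"
  unfolding first_run_def by (auto intro!: determined_upto_intros)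

definition no_run_upto :: "'a \<Rightarrow> nat \<Rightarrow> nat \<Rightarrow> (nat \<Rightarrow> 'a) \<Rightarrow> bool" where
  "no_run_upto i d t \<omega> \<longleftrightarrow> (\<forall>u\<in>{..t}. \<not> absent_run i d \<omega> u)"

lemma determined_upto_no_run_upto: "t \<le> u \<Longrightarrow> determined_upto u (no_run_upto i d t)"
  unfolding no_run_upto_def[abs_def] by (auto intro!: determined_upto_intros)

text \<open>A first run is split into what is known one period earlier and a last absence, so that the
  Markov property applies to that last step.\<close>

definition one_short_of_run :: "'a \<Rightarrow> nat \<Rightarrow> nat \<Rightarrow> (nat \<Rightarrow> 'a) \<Rightarrow> bool" where
  "one_short_of_run i d t \<omega> \<longleftrightarrow> no_run_upto i (Suc d) t \<omega> \<and> absent_run i d \<omega> t"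

lemma determined_upto_one_short_of_run: "t \<le> u \<Longrightarrow> determined_upto u (one_short_of_run i d t)"
  unfolding one_short_of_run_def[abs_def] by (auto intro!: determined_upto_intros determined_upto_no_run_upto)

lemma first_run_Suc_iff:
  "first_run i (Suc d) \<omega> (Suc t) \<longleftrightarrow> one_short_of_run i d t \<omega> \<and> \<omega> (Suc t) \<noteq> i"
  unfolding first_run_def one_short_of_run_def no_run_upto_def absent_run_Suc
  by (auto simp: lessThan_Suc_atMost)

text \<open>The first runs at different times are disjoint. Both series miss the trajectories without any
  run, which count as interceptions.\<close>

lemma interception_2_sums:
  fixes \<mu> :: "'a::countable pmf" and K :: "'a \<Rightarrow> 'a pmf"
  assumes "d \<ge> 1"
  defines "P \<equiv> measure (chain_measure \<mu> K)"
  shows first_run_sums: "(\<lambda>t. P {\<omega>. first_run i d \<omega> t}) sums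
      (1 - P {\<omega>. \<forall>t. \<not> absent_run i d \<omega> t})"
    and interception_sums: "(\<lambda>t. P {\<omega>. first_run i d \<omega> t \<and> \<omega> (Suc t) = i}) sums
      (interception_prob 2 \<mu> K i d - P {\<omega>. \<forall>t. \<not> absent_run i d \<omega> t})"
proof -
  let ?M = "chain_measure \<mu> K"
  interpret prob_space ?M by (rule prob_space_chain_measure)
  let ?N = "{\<omega>. \<forall>t. \<not> absent_run i d \<omega> t}"
  let ?R = "\<lambda>t. {\<omega>. first_run i d \<omega> t}"
  let ?I = "\<lambda>t. {\<omega>. first_run i d \<omega> t \<and> \<omega> (Suc t) = i}"
  have R: "?R t \<in> sets ?M" for t
    by (rule sets_determined_upto[of t]) (auto intro: determined_upto_first_run)
  have I: "?I t \<in> sets ?M" for t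
    by (rule sets_determined_upto[of "Suc t"])
      (auto intro!: determined_upto_first_run determined_upto_intros)
  have run: "(\<exists>t. absent_run i d \<omega> t) \<longleftrightarrow> (\<exists>t. first_run i d \<omega> t)" for \<omega>
    using first_run_iff_Least[of i d \<omega>] by (auto simp: first_run_def)
  have N_eq: "?N = space ?M - (\<Union>t. ?R t)"
    using run by auto
  have N: "?N \<in> sets ?M"
    unfolding N_eq using R by (intro sets.compl_sets sets.countable_UN) auto
  have "(\<lambda>t. P (?R t)) sums P (\<Union>t. ?R t)"
    unfolding P_def using R first_run_unique
    by (intro finite_measure_UNION) (force simp: disjoint_family_on_def)+
  moreover have "P (\<Union>t. ?R t) = 1 - P ?N"
    unfolding N_eq P_def using R by (subst prob_compl) auto
  ultimately show "(\<lambda>t. P (?R t)) sums (1 - P ?N)" by simp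
  have "(\<lambda>t. P (?I t)) sums P (\<Union>t. ?I t)"
    unfolding P_def using I first_run_unique
    by (intro finite_measure_UNION) (force simp: disjoint_family_on_def)+
  moreover have "interception_prob 2 \<mu> K i d = P (?N \<union> (\<Union>t. ?I t))"
    unfolding interception_prob_def P_def intercepted_2_iff[OF assms(1)]
    by (rule arg_cong[of _ _ prob]) auto
  moreover have "P (?N \<union> (\<Union>t. ?I t)) = P ?N + P (\<Union>t. ?I t)"
    unfolding P_def using N I by (intro finite_measure_Union) (auto simp: first_run_def)
  ultimately show "(\<lambda>t. P (?I t)) sums (interception_prob 2 \<mu> K i d - P ?N)" by simp
qed

text \<open>Weighting the attacks by their starting time, the interception probability is an average of
  the success rates against them and of \<open>1\<close>, the payoff if no attack takes place.\<close>

lemma interception_prob_2_ge: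
  fixes \<mu> :: "'a::countable pmf"
  assumes "d \<ge> 1" "v \<le> 1"
    and "\<And>t. v * measure (chain_measure \<mu> K) {\<omega>. first_run i d \<omega> t} \<le>
      measure (chain_measure \<mu> K) {\<omega>. first_run i d \<omega> t \<and> \<omega> (Suc t) = i}"
  shows "v \<le> interception_prob 2 \<mu> K i d"
proof -
  let ?N = "measure (chain_measure \<mu> K) {\<omega>. \<forall>t. \<not> absent_run i d \<omega> t}"
  have "v * (1 - ?N) \<le> interception_prob 2 \<mu> K i d - ?N"
    by (rule sums_le[OF assms(3) sums_mult interception_sums])
      (use assms(1) first_run_sums in auto)
  moreover have "v * ?N \<le> 1 * ?N"
    using assms(2) by (intro mult_right_mono) auto
  ultimately show ?thesis by (simp add: algebra_simps)
qed

lemma interception_prob_2_eq: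
  fixes \<mu> :: "'a::countable pmf"
  assumes "d \<ge> 1" and "measure (chain_measure \<mu> K) {\<omega>. \<forall>t. \<not> absent_run i d \<omega> t} = 0"
    and "\<And>t. measure (chain_measure \<mu> K) {\<omega>. first_run i d \<omega> t \<and> \<omega> (Suc t) = i} =
      v * measure (chain_measure \<mu> K) {\<omega>. first_run i d \<omega> t}"
  shows "interception_prob 2 \<mu> K i d = v"
proof -
  have "(\<lambda>t. v * measure (chain_measure \<mu> K) {\<omega>. first_run i d \<omega> t}) sums (v * 1)"
    using first_run_sums[OF assms(1), of \<mu> K i] assms(2) by (intro sums_mult) simp
  moreover have "(\<lambda>t. v * measure (chain_measure \<mu> K) {\<omega>. first_run i d \<omega> t}) sums
      interception_prob 2 \<mu> K i d"
    using interception_sums[OF assms(1), of \<mu> K i] assms(2,3) by simp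
  ultimately show ?thesis using sums_unique2 by fastforce
qed

lemma interception_prob_bounds: "0 \<le> interception_prob m \<mu> K i d" "interception_prob m \<mu> K i d \<le> 1"
  unfolding interception_prob_def
  by (auto intro: prob_space.prob_le_1[OF prob_space_chain_measure])

section \<open>Patrols of the star\<close>

text \<open>Symmetry reduces a Patroller strategy to the parameters \<open>p\<close> and \<open>s\<close>. The axioms record only
  the transition probabilities that the computations use.\<close>

locale star_patrol =
  fixes n :: nat and \<mu> :: "star_node pmf" and K :: "star_node \<Rightarrow> star_node pmf" and p s :: real
  assumes n: "n \<ge> 2" and start: "set_pmf \<mu> \<subseteq> star_nodes n"
    and closed: "x \<in> star_nodes n \<Longrightarrow> set_pmf (K x) \<subseteq> star_nodes n"
    and leave_center: "j \<in> {1..n} \<Longrightarrow> pmf (K Center) (End j) = p"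
    and leave_end: "j \<in> {1..n} \<Longrightarrow> pmf (K (End j)) Center = s"
    and no_shortcut: "j \<in> {1..n} \<Longrightarrow> k \<in> {1..n} \<Longrightarrow> j \<noteq> k \<Longrightarrow> pmf (K (End j)) (End k) = 0"
    and p_pos: "p > 0" and s_pos: "s > 0"
begin

abbreviation P :: "((nat \<Rightarrow> star_node) \<Rightarrow> bool) \<Rightarrow> real" where
  "P Q \<equiv> measure (chain_measure \<mu> K) {\<omega>. Q \<omega>}"

lemma stay_center: "pmf (K Center) Center = 1 - real n * p"
proof -
  have "(\<Sum>x\<in>star_nodes n. pmf (K Center) x) = 1"
    by (rule sum_pmf_eq_1) (use closed[of Center] in \<open>auto simp: star_nodes_def\<close>)
  moreover have "(\<Sum>x\<in>End ` {1..n}. pmf (K Center) x) = real n * p"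
    by (subst sum.reindex) (auto simp: inj_on_def leave_center)
  ultimately show ?thesis
    by (simp add: star_nodes_def image_iff)
qed

lemma np_le_1: "real n * p \<le> 1"
  using stay_center pmf_nonneg[of "K Center" Center] by linarith

lemma p_less_1: "p < 1"
proof -
  have "2 * p \<le> real n * p" using n p_pos by (intro mult_right_mono) auto
  then show ?thesis using np_le_1 p_pos by linarith
qed

lemma s_le_1: "s \<le> 1"
  using leave_end[of 1] n pmf_le_1[of "K (End 1)" Center] by simp

lemma P_step:
  assumes "determined_upto t Q"
    and "\<And>\<omega>. Q \<omega> \<Longrightarrow> \<omega> t \<in> star_nodes n \<Longrightarrow> measure_pmf.prob (K (\<omega> t)) Y = q"
  shows "P (\<lambda>\<omega>. Q \<omega> \<and> \<omega> (Suc t) \<in> Y) = q * P Q"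
  using markov_property[OF assms(1) start closed assms(2)] .

lemma P_step_point:
  assumes "determined_upto t Q"
    and "\<And>\<omega>. Q \<omega> \<Longrightarrow> \<omega> t \<in> star_nodes n \<Longrightarrow> pmf (K (\<omega> t)) y = q"
  shows "P (\<lambda>\<omega>. Q \<omega> \<and> \<omega> (Suc t) = y) = q * P Q"
  using P_step[of t Q "{y}" q] assms by (simp add: measure_pmf_single)

lemma P_step_avoid:
  assumes "determined_upto t Q"
    and "\<And>\<omega>. Q \<omega> \<Longrightarrow> \<omega> t \<in> star_nodes n \<Longrightarrow> pmf (K (\<omega> t)) y = q"
  shows "P (\<lambda>\<omega>. Q \<omega> \<and> \<omega> (Suc t) \<noteq> y) = (1 - q) * P Q"
  using P_step[of t Q "- {y}" "1 - q"] assms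
  by (simp add: measure_pmf_single measure_pmf.prob_compl[of "{y}", unfolded space_measure_pmf, folded Compl_eq_Diff_UNIV])

lemma P_split:
  assumes "determined_upto t Q" "determined_upto t R"
  shows "P Q = P (\<lambda>\<omega>. Q \<omega> \<and> R \<omega>) + P (\<lambda>\<omega>. Q \<omega> \<and> \<not> R \<omega>)"
proof -
  interpret prob_space "chain_measure \<mu> K" by (rule prob_space_chain_measure)
  have "{\<omega>. Q \<omega>} = {\<omega>. Q \<omega> \<and> R \<omega>} \<union> {\<omega>. Q \<omega> \<and> \<not> R \<omega>}" by auto
  moreover have "P (\<lambda>\<omega>. Q \<omega> \<and> R \<omega>) + P (\<lambda>\<omega>. Q \<omega> \<and> \<not> R \<omega>) = prob ({\<omega>. Q \<omega> \<and> R \<omega>} \<union> {\<omega>. Q \<omega> \<and> \<not> R \<omega>})"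
    using assms
    by (intro finite_measure_Union[symmetric] sets_determined_upto[of t] determined_upto_intros) auto
  ultimately show ?thesis by simp
qed

lemma P_mono:
  assumes "determined_upto t R" "\<And>\<omega>. Q \<omega> \<Longrightarrow> R \<omega>"
  shows "P Q \<le> P R"
proof -
  interpret prob_space "chain_measure \<mu> K" by (rule prob_space_chain_measure)
  show ?thesis
    using assms by (intro finite_measure_mono sets_determined_upto[OF assms(1)]) auto
qed

lemma P_split_center:
  assumes "determined_upto t Q"
  shows "P (\<lambda>\<omega>. Q \<omega> \<and> R (\<omega> (Suc t))) = P (\<lambda>\<omega>. (Q \<omega> \<and> \<omega> t = Center) \<and> R (\<omega> (Suc t))) +
    P (\<lambda>\<omega>. (Q \<omega> \<and> \<omega> t \<noteq> Center) \<and> R (\<omega> (Suc t)))"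
proof -
  have "determined_upto (Suc t) (\<lambda>\<omega>. R (\<omega> (Suc t)))"
    by (simp add: determined_upto_def)
  then have "P (\<lambda>\<omega>. Q \<omega> \<and> R (\<omega> (Suc t))) = P (\<lambda>\<omega>. (Q \<omega> \<and> R (\<omega> (Suc t))) \<and> \<omega> t = Center) +
      P (\<lambda>\<omega>. (Q \<omega> \<and> R (\<omega> (Suc t))) \<and> \<omega> t \<noteq> Center)"
    by (intro P_split[of "Suc t"] determined_upto_intros determined_upto_mono[OF assms]) auto
  then show ?thesis by (simp add: conj_ac)
qed

text \<open>An end can be entered from the center only.\<close>

lemma P_return_to_end:
  assumes j: "j \<in> {1..n}" and Q: "determined_upto t Q"
  shows "P (\<lambda>\<omega>. (Q \<omega> \<and> \<omega> t \<noteq> End j) \<and> \<omega> (Suc t) = End j) = p * P (\<lambda>\<omega>. Q \<omega> \<and> \<omega> t = Center)"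
proof -
  let ?Q = "\<lambda>\<omega>. Q \<omega> \<and> \<omega> t \<noteq> End j"
  have Q': "determined_upto t ?Q"
    by (intro determined_upto_intros Q) auto
  have "P (\<lambda>\<omega>. (?Q \<omega> \<and> \<omega> t = Center) \<and> \<omega> (Suc t) = End j) = p * P (\<lambda>\<omega>. ?Q \<omega> \<and> \<omega> t = Center)"
    using j by (intro P_step_point determined_upto_intros Q) (auto simp: leave_center[simplified])
  moreover have "P (\<lambda>\<omega>. (?Q \<omega> \<and> \<omega> t \<noteq> Center) \<and> \<omega> (Suc t) = End j) =
      0 * P (\<lambda>\<omega>. ?Q \<omega> \<and> \<omega> t \<noteq> Center)"
    using j by (intro P_step_point determined_upto_intros Q) (auto simp: star_nodes_def no_shortcut)
  moreover have "(\<lambda>\<omega>. ?Q \<omega> \<and> \<omega> t = Center) = (\<lambda>\<omega>. Q \<omega> \<and> \<omega> t = Center)"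
    by auto
  ultimately show ?thesis
    using P_split_center[OF Q', of "\<lambda>x. x = End j"] by simp
qed

lemma P_first_run_return:
  assumes j: "j \<in> {1..n}"
  shows "P (\<lambda>\<omega>. first_run (End j) (Suc d) \<omega> (Suc t) \<and> \<omega> (Suc (Suc t)) = End j) =
    p * P (\<lambda>\<omega>. one_short_of_run (End j) d t \<omega> \<and> \<omega> (Suc t) = Center)"
  unfolding first_run_Suc_iff by (intro P_return_to_end determined_upto_one_short_of_run j) auto

text \<open>In the first period of absence from an end the Patroller is at the center. From there \<open>1 - p\<close>
  is the probability of a second absence and \<open>1 - n p\<close> that of staying, the only kind of second
  absence after which he can return at once.\<close>

lemma P_first_run_2_return:
  assumes j: "j \<in> {1..n}"
  shows "P (\<lambda>\<omega>. first_run (End j) 2 \<omega> t \<and> \<omega> (Suc t) = End j) =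
    p * (1 - real n * p) / (1 - p) * P (\<lambda>\<omega>. first_run (End j) 2 \<omega> t)"
proof (cases t)
  case 0
  then show ?thesis by (simp add: first_run_def not_absent_run_Suc_0 numeral_2_eq_2)
next
  case (Suc u)
  let ?B = "one_short_of_run (End j) 1 u"
  let ?a = "P (\<lambda>\<omega>. ?B \<omega> \<and> \<omega> u = Center)"
  have B: "determined_upto u ?B"
    by (rule determined_upto_one_short_of_run) simp
  \<comment> \<open>After a single absence from an end he is at the center.\<close>
  have null: "P (\<lambda>\<omega>. ?B \<omega> \<and> \<omega> u \<noteq> Center) = 0"
  proof (cases u)
    case 0
    then show ?thesis by (simp add: one_short_of_run_def not_absent_run_Suc_0)
  next
    case (Suc v)
    have "P (\<lambda>\<omega>. ?B \<omega> \<and> \<omega> u \<noteq> Center) \<le> P (\<lambda>\<omega>. \<omega> v = End j \<and> \<omega> (Suc v) \<in> - {End j, Center})"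
      by (rule P_mono[of u])
        (auto simp: Suc one_short_of_run_def absent_run_Suc absent_run_0 intro!: determined_upto_intros)
    also have "\<dots> = 0 * P (\<lambda>\<omega>. \<omega> v = End j)"
    proof (rule P_step)
      have "set_pmf (K (End j)) \<subseteq> {End j, Center}"
      proof
        fix x assume x: "x \<in> set_pmf (K (End j))"
        then have "x \<in> star_nodes n"
          using j closed[of "End j"] by (auto simp: star_nodes_def)
        then show "x \<in> {End j, Center}"
          using x no_shortcut[OF j] unfolding star_nodes_def set_pmf_iff by blast
      qed
      then have "measure_pmf.prob (K (End j)) (- {End j, Center}) = 0"
        by (auto simp: measure_pmf_zero_iff)
      then show "measure_pmf.prob (K (\<omega> v)) (- {End j, Center}) = 0" if "\<omega> v = End j" for \<omega>
        using that by simp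
    qed (auto intro!: determined_upto_intros)
    finally show ?thesis by (simp add: measure_le_0_iff)
  qed
  have split: "P (\<lambda>\<omega>. ?B \<omega> \<and> Q (\<omega> (Suc u))) = P (\<lambda>\<omega>. (?B \<omega> \<and> \<omega> u = Center) \<and> Q (\<omega> (Suc u)))" for Q
  proof -
    have "P (\<lambda>\<omega>. (?B \<omega> \<and> \<omega> u \<noteq> Center) \<and> Q (\<omega> (Suc u))) \<le> P (\<lambda>\<omega>. ?B \<omega> \<and> \<omega> u \<noteq> Center)"
      using B by (intro P_mono[of u] determined_upto_intros) auto
    then show ?thesis
      using P_split_center[OF B, of Q] null by (simp add: measure_le_0_iff)
  qed
  have "P (\<lambda>\<omega>. ?B \<omega> \<and> \<omega> (Suc u) = Center) = (1 - real n * p) * ?a"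
    unfolding split[of "\<lambda>x. x = Center"]
    using B by (intro P_step_point determined_upto_intros) (auto simp: stay_center)
  then have "P (\<lambda>\<omega>. first_run (End j) 2 \<omega> t \<and> \<omega> (Suc t) = End j) = p * ((1 - real n * p) * ?a)"
    using P_first_run_return[OF j, of 1 u] by (simp add: Suc numeral_2_eq_2)
  moreover have "P (\<lambda>\<omega>. ?B \<omega> \<and> \<omega> (Suc u) \<noteq> End j) = (1 - p) * ?a"
    unfolding split[of "\<lambda>x. x \<noteq> End j"]
    using B by (intro P_step_avoid determined_upto_intros) (use j in \<open>auto simp: leave_center[simplified]\<close>)
  then have "P (\<lambda>\<omega>. first_run (End j) 2 \<omega> t) = (1 - p) * ?a"
    using first_run_Suc_iff[of "End j" 1 _ u] by (simp add: Suc numeral_2_eq_2)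
  ultimately show ?thesis
    using p_less_1 by simp
qed

text \<open>With reflection, a Patroller who is not at the center one period before the run is complete
  moves there and can then return at once. Such positions, possible only for delays other than two,
  therefore favour him.\<close>

lemma P_first_run_reflecting:
  assumes j: "j \<in> {1..n}" and "s = 1" and "d \<ge> 1"
  shows "p * (1 - real n * p) / (1 - p) * P (\<lambda>\<omega>. first_run (End j) d \<omega> t) \<le>
    P (\<lambda>\<omega>. first_run (End j) d \<omega> t \<and> \<omega> (Suc t) = End j)"
proof (cases t)
  case 0
  then show ?thesis
    using \<open>d \<ge> 1\<close> not_absent_run_Suc_0[of "End j" "d - 1"] by (simp add: first_run_def)
next
  case (Suc u)
  obtain e where d: "d = Suc e" using \<open>d \<ge> 1\<close> by (cases d) auto
  let ?B = "one_short_of_run (End j) e u"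
  let ?r = "1 - real n * p"
  let ?a = "P (\<lambda>\<omega>. ?B \<omega> \<and> \<omega> u = Center)" and ?b = "P (\<lambda>\<omega>. ?B \<omega> \<and> \<omega> u \<noteq> Center)"
  have B: "determined_upto u ?B"
    by (rule determined_upto_one_short_of_run) simp
  have reflect: "pmf (K x) Center = 1" "pmf (K x) (End j) = 0" if "x \<in> star_nodes n" "x \<noteq> Center" for x
  proof -
    show 1: "pmf (K x) Center = 1"
      using that leave_end \<open>s = 1\<close> by (auto simp: star_nodes_def)
    then have "set_pmf (K x) \<subseteq> {Center}"
      using measure_pmf.prob_eq_1[of "{Center}" "K x"] by (auto simp: measure_pmf_single AE_measure_pmf_iff)
    then show "pmf (K x) (End j) = 0" by (auto simp: set_pmf_iff)
  qed
  have "P (\<lambda>\<omega>. ?B \<omega> \<and> \<omega> (Suc u) = Center) = ?r * ?a + 1 * ?b"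
    unfolding P_split_center[OF B, of "\<lambda>x. x = Center"]
    using B by (intro arg_cong2[of _ _ _ _ "(+)"] P_step_point determined_upto_intros)
      (auto simp: stay_center reflect)
  then have hit: "P (\<lambda>\<omega>. first_run (End j) d \<omega> t \<and> \<omega> (Suc t) = End j) = p * (?r * ?a + ?b)"
    using P_first_run_return[OF j, of e u] by (simp add: Suc d)
  have "P (\<lambda>\<omega>. ?B \<omega> \<and> \<omega> (Suc u) \<noteq> End j) = (1 - p) * ?a + (1 - 0) * ?b"
    unfolding P_split_center[OF B, of "\<lambda>x. x \<noteq> End j"]
    using B by (intro arg_cong2[of _ _ _ _ "(+)"] P_step_avoid determined_upto_intros)
      (use j in \<open>auto simp: leave_center[simplified] reflect\<close>)
  then have run: "P (\<lambda>\<omega>. first_run (End j) d \<omega> t) = (1 - p) * ?a + ?b"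
    using first_run_Suc_iff[of "End j" e _ u] by (simp add: Suc d)
  have "1 * p \<le> real n * p"
    using n p_pos by (intro mult_right_mono) auto
  then have "?r / (1 - p) \<le> 1"
    using p_less_1 by simp
  then have "?r / (1 - p) * ?b \<le> 1 * ?b"
    by (intro mult_right_mono) auto
  moreover have "?r / (1 - p) * ((1 - p) * ?a + ?b) = ?r * ?a + ?r / (1 - p) * ?b"
    using p_less_1 by (simp add: distrib_left)
  ultimately have "p * (?r / (1 - p) * ((1 - p) * ?a + ?b)) \<le> p * (?r * ?a + ?b)"
    using p_pos by (intro mult_left_mono) auto
  then show ?thesis unfolding hit run by simp
qed

text \<open>The itinerary center, attacked end, center, anything but that end contains a run.\<close>

lemma P_run_from_center:
  assumes j: "j \<in> {1..n}" and Q: "determined_upto t Q"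
  shows "p * s * (1 - p) * P (\<lambda>\<omega>. Q \<omega> \<and> \<omega> t = Center) \<le>
    P (\<lambda>\<omega>. (Q \<omega> \<and> \<omega> t = Center) \<and> absent_run (End j) 2 \<omega> (t + 3))"
proof -
  let ?Q = "\<lambda>\<omega>. Q \<omega> \<and> \<omega> t = Center"
  have 1: "P (\<lambda>\<omega>. ?Q \<omega> \<and> \<omega> (Suc t) = End j) = p * P ?Q"
    using j Q by (intro P_step_point determined_upto_intros) (auto simp: leave_center[simplified])
  have 2: "P (\<lambda>\<omega>. (?Q \<omega> \<and> \<omega> (Suc t) = End j) \<and> \<omega> (Suc (Suc t)) = Center) =
      s * P (\<lambda>\<omega>. ?Q \<omega> \<and> \<omega> (Suc t) = End j)"
    using j Q by (intro P_step_point determined_upto_intros)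
      (auto simp: leave_end[simplified] intro!: determined_upto_mono[OF Q])
  have 3: "P (\<lambda>\<omega>. ((?Q \<omega> \<and> \<omega> (Suc t) = End j) \<and> \<omega> (Suc (Suc t)) = Center) \<and>
        \<omega> (Suc (Suc (Suc t))) \<noteq> End j) =
      (1 - p) * P (\<lambda>\<omega>. (?Q \<omega> \<and> \<omega> (Suc t) = End j) \<and> \<omega> (Suc (Suc t)) = Center)"
    by (intro P_step_avoid determined_upto_intros)
      (use j Q in \<open>auto simp: leave_center[simplified] intro!: determined_upto_mono[OF Q]\<close>)
  have run: "absent_run (End j) 2 \<omega> (t + 3) \<longleftrightarrow>
      \<omega> (Suc t) = End j \<and> \<omega> (Suc (Suc t)) \<noteq> End j \<and> \<omega> (Suc (Suc (Suc t))) \<noteq> End j" for \<omega>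
    by (simp add: numeral_2_eq_2 numeral_3_eq_3 absent_run_Suc absent_run_0)
  have "P (\<lambda>\<omega>. ((?Q \<omega> \<and> \<omega> (Suc t) = End j) \<and> \<omega> (Suc (Suc t)) = Center) \<and>
        \<omega> (Suc (Suc (Suc t))) \<noteq> End j) \<le> P (\<lambda>\<omega>. ?Q \<omega> \<and> absent_run (End j) 2 \<omega> (t + 3))"
    using Q by (intro P_mono[of "t + 3"] determined_upto_intros) (auto simp: run intro!: determined_upto_mono[OF Q])
  then show ?thesis unfolding 3 2 1 by (simp only: mult_ac)
qed

text \<open>The itinerary above takes three periods from the center; from an end one more step, of
  probability \<open>s\<close>, leads to the center first. The factor \<open>s\<close> is lost in both cases to obtain a
  common rate.\<close>

lemma P_no_run_decay:
  assumes j: "j \<in> {1..n}"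
  shows "P (no_run_upto (End j) 2 (t + 4)) \<le> (1 - s * (p * s * (1 - p))) * P (no_run_upto (End j) 2 t)"
proof -
  let ?F = "no_run_upto (End j) 2" and ?e = "p * s * (1 - p)"
  let ?A = "\<lambda>\<omega>. ?F t \<omega> \<and> \<omega> t = Center" and ?B = "\<lambda>\<omega>. ?F t \<omega> \<and> \<omega> t \<noteq> Center"
  let ?B' = "\<lambda>\<omega>. ?B \<omega> \<and> \<omega> (Suc t) = Center"
  have F: "determined_upto u (?F v)" if "v \<le> u" for u v
    using that by (rule determined_upto_no_run_upto)
  have e: "0 \<le> ?e" using p_pos s_pos p_less_1 by simp
  have tot: "P (?F t) = P ?A + P ?B"
    by (intro P_split[of t] F determined_upto_intros) auto
  have "P (?F (t + 4)) = P (\<lambda>\<omega>. ?F (t + 4) \<omega> \<and> \<omega> t = Center) + P (\<lambda>\<omega>. ?F (t + 4) \<omega> \<and> \<omega> t \<noteq> Center)"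
    by (intro P_split[of "t + 4"] F determined_upto_intros) auto
  moreover have "P (\<lambda>\<omega>. ?F (t + 4) \<omega> \<and> \<omega> t = Center) \<le> P (\<lambda>\<omega>. ?A \<omega> \<and> \<not> absent_run (End j) 2 \<omega> (t + 3))"
    by (intro P_mono[of "t + 3"] F determined_upto_intros) (auto simp: no_run_upto_def)
  moreover have "P ?A = P (\<lambda>\<omega>. ?A \<omega> \<and> absent_run (End j) 2 \<omega> (t + 3)) +
      P (\<lambda>\<omega>. ?A \<omega> \<and> \<not> absent_run (End j) 2 \<omega> (t + 3))"
    by (intro P_split[of "t + 3"] F determined_upto_intros) auto
  moreover have "P (\<lambda>\<omega>. ?F (t + 4) \<omega> \<and> \<omega> t \<noteq> Center) \<le>
      P (\<lambda>\<omega>. ?B \<omega> \<and> \<not> (\<omega> (Suc t) = Center \<and> absent_run (End j) 2 \<omega> (t + 4)))"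
    by (intro P_mono[of "t + 4"] F determined_upto_intros) (auto simp: no_run_upto_def)
  moreover have "P ?B = P (\<lambda>\<omega>. ?B \<omega> \<and> \<omega> (Suc t) = Center \<and> absent_run (End j) 2 \<omega> (t + 4)) +
      P (\<lambda>\<omega>. ?B \<omega> \<and> \<not> (\<omega> (Suc t) = Center \<and> absent_run (End j) 2 \<omega> (t + 4)))"
    by (intro P_split[of "t + 4"] F determined_upto_intros) auto
  moreover have "?e * P ?A \<le> P (\<lambda>\<omega>. ?A \<omega> \<and> absent_run (End j) 2 \<omega> (t + 3))"
    by (intro P_run_from_center F j) simp
  moreover have "s * ?e * P ?A \<le> 1 * ?e * P ?A"
    using s_le_1 e by (intro mult_right_mono) auto
  moreover have "?e * P ?B' \<le> P (\<lambda>\<omega>. ?B \<omega> \<and> \<omega> (Suc t) = Center \<and> absent_run (End j) 2 \<omega> (t + 4))"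
  proof -
    have "determined_upto (Suc t) ?B"
      by (intro determined_upto_intros F) auto
    moreover have "Suc t + 3 = t + 4" by simp
    ultimately show ?thesis
      using P_run_from_center[OF j, of "Suc t" ?B] by (simp only: conj_assoc)
  qed
  moreover have "P ?B' = s * P ?B"
    by (intro P_step_point F determined_upto_intros) (auto simp: star_nodes_def leave_end)
  ultimately show ?thesis
    unfolding tot by (simp add: algebra_simps)
qed

text \<open>Since the decay rate is uniform in time, the probability of no run up to period \<open>4 k\<close> tends to
  zero geometrically.\<close>

lemma P_never_run_2:
  assumes j: "j \<in> {1..n}"
  shows "P (\<lambda>\<omega>. \<forall>t. \<not> absent_run (End j) 2 \<omega> t) = 0"
proof -
  interpret prob_space "chain_measure \<mu> K" by (rule prob_space_chain_measure)
  let ?c = "1 - s * (p * s * (1 - p))" and ?N = "P (\<lambda>\<omega>. \<forall>t. \<not> absent_run (End j) 2 \<omega> t)"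
  have pos: "s * (p * s * (1 - p)) > 0"
    using p_pos s_pos p_less_1 by simp
  have "s * (p * s * (1 - p)) \<le> 1"
    using p_pos s_pos p_less_1 s_le_1 by (intro mult_le_one) auto
  then have c: "0 \<le> ?c" "?c < 1" using pos by auto
  have "P (no_run_upto (End j) 2 (4 * k)) \<le> ?c ^ k" for k
  proof (induction k)
    case (Suc k)
    have "P (no_run_upto (End j) 2 (4 * Suc k)) \<le> ?c * P (no_run_upto (End j) 2 (4 * k))"
      using P_no_run_decay[OF j, of "4 * k"] by (simp add: add.commute)
    also have "\<dots> \<le> ?c * ?c ^ k"
      using Suc c by (intro mult_left_mono) auto
    finally show ?case by simp
  qed simp
  moreover have "?N \<le> P (no_run_upto (End j) 2 (4 * k))" for k
    by (rule P_mono[of "4 * k"]) (rule determined_upto_no_run_upto, simp, simp add: no_run_upto_def)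
  ultimately have "?N \<le> ?c ^ k" for k
    using order_trans by blast
  then have "?N \<le> 0"
    using c by (intro LIMSEQ_le_const[OF LIMSEQ_power_zero]) auto
  then show ?thesis by (simp add: measure_le_0_iff)
qed

lemma interception_prob_end_2:
  "j \<in> {1..n} \<Longrightarrow> interception_prob 2 \<mu> K (End j) 2 = p * (1 - real n * p) / (1 - p)"
  by (intro interception_prob_2_eq P_never_run_2 P_first_run_2_return) auto

lemma interception_prob_end_reflecting:
  assumes "j \<in> {1..n}" "s = 1" "d \<ge> 1"
  shows "p * (1 - real n * p) / (1 - p) \<le> interception_prob 2 \<mu> K (End j) d"
proof (rule interception_prob_2_ge[OF assms(3)])
  have "1 * p \<le> real n * p"
    using n p_pos by (intro mult_right_mono) auto
  moreover have "p * (1 - real n * p) \<le> 1 * (1 - real n * p)"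
    using np_le_1 p_less_1 by (intro mult_right_mono) auto
  ultimately have "p * (1 - real n * p) \<le> 1 - p" by simp
  then show "p * (1 - real n * p) / (1 - p) \<le> 1" using p_less_1 by simp
qed (rule P_first_run_reflecting[OF assms])

lemma interception_prob_center_reflecting:
  assumes "s = 1" "d \<ge> 1"
  shows "interception_prob 2 \<mu> K Center d = 1"
proof -
  interpret prob_space "chain_measure \<mu> K" by (rule prob_space_chain_measure)
  have "v * P (\<lambda>\<omega>. first_run Center d \<omega> t) \<le> P (\<lambda>\<omega>. first_run Center d \<omega> t \<and> \<omega> (Suc t) = Center)"
    if "v = 1" for t v
  proof -
    have "P (\<lambda>\<omega>. first_run Center d \<omega> t \<and> \<omega> (Suc t) = Center) = 1 * P (\<lambda>\<omega>. first_run Center d \<omega> t)"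
    proof (rule P_step_point)
      fix \<omega> assume "first_run Center d \<omega> t" "\<omega> t \<in> star_nodes n"
      then have "\<omega> t \<in> End ` {1..n}"
        using assms(2) by (auto simp: first_run_def absent_run_def star_nodes_def)
      then show "pmf (K (\<omega> t)) Center = 1"
        using leave_end assms(1) by auto
    qed (simp add: determined_upto_first_run)
    then show ?thesis using that by simp
  qed
  then have "1 \<le> interception_prob 2 \<mu> K Center d"
    using assms(2) by (intro interception_prob_2_ge) auto
  then show ?thesis
    using interception_prob_bounds(2)[of 2 \<mu> K Center d] by linarith
qed

end


section \<open>Saddle points\<close>

lemma payoff_ge:
  assumes "\<And>i d. (i, d) \<in> set_pmf A \<Longrightarrow> v \<le> interception_prob m \<mu> K i d"
  shows "v \<le> payoff m \<mu> K A"
  unfolding payoff_def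
proof (rule measure_pmf.integral_ge_const)
  show "integrable (measure_pmf A) (\<lambda>(i, d). interception_prob m \<mu> K i d)"
    using interception_prob_bounds[of m \<mu> K]
    by (intro measure_pmf.integrable_const_bound[where B = 1]) (auto split: prod.split)
qed (use assms in \<open>auto simp: AE_measure_pmf_iff\<close>)

lemma payoff_le:
  assumes "\<And>i d. (i, d) \<in> set_pmf A \<Longrightarrow> interception_prob m \<mu> K i d \<le> v"
  shows "payoff m \<mu> K A \<le> v"
  unfolding payoff_def
proof (rule measure_pmf.integral_le_const)
  show "integrable (measure_pmf A) (\<lambda>(i, d). interception_prob m \<mu> K i d)"
    using interception_prob_bounds[of m \<mu> K]
    by (intro measure_pmf.integrable_const_bound[where B = 1]) (auto split: prod.split)
qed (use assms in \<open>auto simp: AE_measure_pmf_iff\<close>)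

lemma payoff_nonneg: "0 \<le> payoff m \<mu> K A"
  by (intro payoff_ge interception_prob_bounds)

lemma saddle_point:
  assumes K: "K \<in> patroller_strategies V E" and A: "A \<in> attacker_strategies V D"
    and K_ge: "\<And>A'. A' \<in> attacker_strategies V D \<Longrightarrow> v \<le> payoff m \<mu> K A'"
    and A_le: "\<And>K'. K' \<in> patroller_strategies V E \<Longrightarrow> payoff m \<mu> K' A \<le> v"
  shows "game_value V E m D \<mu> = v" "payoff m \<mu> K A = v"
    "patroller_optimal V E m D \<mu> K" "attacker_optimal V E m D \<mu> A"
proof -
  let ?g = "\<lambda>K. INF A\<in>attacker_strategies V D. payoff m \<mu> K A"
  have le: "?g K' \<le> v" if "K' \<in> patroller_strategies V E" for K'
  proof -
    have "?g K' \<le> payoff m \<mu> K' A"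
      using payoff_nonneg A by (intro cINF_lower bdd_belowI2[where m = 0]) auto
    then show ?thesis using A_le[OF that] by simp
  qed
  have "v \<le> ?g K"
    using A K_ge by (intro cINF_greatest) auto
  also have "?g K \<le> game_value V E m D \<mu>"
    unfolding game_value_def using K le by (intro cSUP_upper bdd_aboveI2) auto
  finally have "v \<le> game_value V E m D \<mu>" .
  moreover have "game_value V E m D \<mu> \<le> v"
    unfolding game_value_def using K le by (intro cSUP_least) auto
  ultimately show v: "game_value V E m D \<mu> = v" by simp
  show "payoff m \<mu> K A = v"
    using K_ge[OF A] A_le[OF K] by simp
  show "patroller_optimal V E m D \<mu> K" "attacker_optimal V E m D \<mu> A"
    unfolding patroller_optimal_def attacker_optimal_def v using K A K_ge A_le by auto
qed

section \<open>Patroller strategies on the star\<close>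

definition permute_ends :: "(nat \<Rightarrow> nat) \<Rightarrow> star_node \<Rightarrow> star_node" where
  "permute_ends \<pi> x = (case x of Center \<Rightarrow> Center | End k \<Rightarrow> End (\<pi> k))"

lemma permute_ends_symmetry:
  assumes "bij_betw \<pi> {1..n} {1..n}"
  shows "permute_ends \<pi> \<in> network_symmetries (star_nodes n) (star_edge n)"
proof -
  have inj: "inj_on \<pi> {1..n}" and im: "\<pi> ` {1..n} = {1..n}"
    using assms by (auto simp: bij_betw_def)
  have "inj_on (permute_ends \<pi>) (star_nodes n)"
    using inj by (intro inj_onI) (auto simp: star_nodes_def permute_ends_def inj_on_eq_iff)
  moreover have "permute_ends \<pi> ` star_nodes n = star_nodes n"
  proof -
    have "permute_ends \<pi> ` star_nodes n = insert Center (End ` \<pi> ` {1..n})"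
      by (auto simp: star_nodes_def permute_ends_def image_image)
    then show ?thesis unfolding im by (simp add: star_nodes_def)
  qed
  moreover have "star_edge n (permute_ends \<pi> x) (permute_ends \<pi> y) \<longleftrightarrow> star_edge n x y"
    if "x \<in> star_nodes n" "y \<in> star_nodes n" for x y
    using that im by (force simp: star_edge_def star_nodes_def permute_ends_def split: star_node.splits)
  ultimately show ?thesis
    by (simp add: network_symmetries_def bij_betw_def)
qed

text \<open>With at least two ends, the center is the only node with more than one neighbour, so every
  symmetry fixes it. For \<open>n = 1\<close> the two nodes can be exchanged.\<close>

lemma star_symmetryE:
  assumes "n \<ge> 2" and f: "f \<in> network_symmetries (star_nodes n) (star_edge n)"
  obtains \<pi> where "f Center = Center" "inj_on \<pi> {1..n}"
    "\<And>k. k \<in> {1..n} \<Longrightarrow> \<pi> k \<in> {1..n}" "\<And>k. k \<in> {1..n} \<Longrightarrow> f (End k) = End (\<pi> k)"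
proof -
  have bij: "bij_betw f (star_nodes n) (star_nodes n)"
    and edge: "\<And>x y. x \<in> star_nodes n \<Longrightarrow> y \<in> star_nodes n \<Longrightarrow>
      star_edge n (f x) (f y) \<longleftrightarrow> star_edge n x y"
    using f by (auto simp: network_symmetries_def)
  have C: "Center \<in> star_nodes n" and E: "\<And>k. k \<in> {1..n} \<Longrightarrow> End k \<in> star_nodes n"
    by (auto simp: star_nodes_def)
  have fC: "f Center = Center"
  proof (rule ccontr)
    assume ne: "f Center \<noteq> Center"
    have "f (End k) = Center" if "k \<in> {1..n}" for k
      using edge[OF C E[OF that]] that ne by (auto simp: star_edge_def)
    then have "f (End 1) = f (End 2)" using \<open>n \<ge> 2\<close> by simp
    moreover have "End 1 \<in> star_nodes n" "End 2 \<in> star_nodes n" using \<open>n \<ge> 2\<close> by (auto intro: E)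
    ultimately show False
      using bij_betw_imp_inj_on[OF bij] by (auto dest: inj_onD)
  qed
  have fE: "f (End k) \<in> End ` {1..n}" if "k \<in> {1..n}" for k
    using edge[OF C E[OF that]] that fC by (auto simp: star_edge_def)
  define \<pi> where "\<pi> k = (case f (End k) of End l \<Rightarrow> l | Center \<Rightarrow> 0)" for k
  have \<pi>: "f (End k) = End (\<pi> k)" "\<pi> k \<in> {1..n}" if "k \<in> {1..n}" for k
    using fE[OF that] by (auto simp: \<pi>_def)
  moreover have "inj_on \<pi> {1..n}"
  proof (rule inj_onI)
    fix k l assume kl: "k \<in> {1..n}" "l \<in> {1..n}" "\<pi> k = \<pi> l"
    then have "f (End k) = f (End l)" by (simp add: \<pi>)
    then show "k = l"
      using inj_onD[OF bij_betw_imp_inj_on[OF bij]] E kl(1,2) by blast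
  qed
  ultimately show ?thesis using fC that by blast
qed

text \<open>Exchanging two ends shows that the transition probabilities do not depend on the end;
  irreducibility forbids staying forever at the center or at an end, so \<open>p\<close> and \<open>s\<close> are positive.\<close>

lemma star_patrol_strategy:
  assumes n: "n \<ge> 2" and \<mu>: "set_pmf \<mu> \<subseteq> star_nodes n"
    and K: "K \<in> patroller_strategies (star_nodes n) (star_edge n)"
  shows "star_patrol n \<mu> K (pmf (K Center) (End 1)) (pmf (K (End 1)) Center)"
proof -
  have step: "\<And>x y. x \<in> star_nodes n \<Longrightarrow> y \<in> set_pmf (K x) \<Longrightarrow>
      y \<in> star_nodes n \<and> (y = x \<or> star_edge n x y)"
    and irr: "irreducible_on (star_nodes n) K"
    and sym: "\<And>f x y. f \<in> network_symmetries (star_nodes n) (star_edge n) \<Longrightarrow>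
      x \<in> star_nodes n \<Longrightarrow> y \<in> star_nodes n \<Longrightarrow> pmf (K (f x)) (f y) = pmf (K x) y"
    using K unfolding patroller_strategies_def by blast+
  have C: "Center \<in> star_nodes n" and E: "\<And>k. k \<in> {1..n} \<Longrightarrow> End k \<in> star_nodes n"
    by (auto simp: star_nodes_def)
  have one: "1 \<in> {1..n}" using n by simp
  have const: "pmf (K Center) (End j) = pmf (K Center) (End 1)"
      "pmf (K (End j)) Center = pmf (K (End 1)) Center" if j: "j \<in> {1..n}" for j
  proof -
    let ?f = "permute_ends (Transposition.transpose 1 j)"
    have "?f \<in> network_symmetries (star_nodes n) (star_edge n)"
      using one j by (intro permute_ends_symmetry) (simp add: bij_betw_transpose_iff)
    from sym[OF this C E[OF one]] sym[OF this E[OF one] C]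
    show "pmf (K Center) (End j) = pmf (K Center) (End 1)"
      "pmf (K (End j)) Center = pmf (K (End 1)) Center"
      by (simp_all add: permute_ends_def)
  qed
  have leaves: "\<exists>y. y \<noteq> x \<and> y \<in> set_pmf (K x)" if x: "x \<in> star_nodes n" for x
  proof (rule ccontr)
    assume stuck: "\<nexists>y. y \<noteq> x \<and> y \<in> set_pmf (K x)"
    obtain y where y: "y \<in> star_nodes n" "y \<noteq> x"
      using C E[OF one] by (metis star_node.distinct(1))
    have "(x, y) \<in> {(a, b). a \<in> star_nodes n \<and> b \<in> set_pmf (K a)}\<^sup>*"
      using irr x y(1) by (simp add: irreducible_on_def)
    then have "y = x"
      by (induction rule: rtrancl_induct) (use stuck in auto)
    then show False using y(2) by simp
  qed
  show ?thesis
  proof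
    obtain y where y: "y \<noteq> Center" "y \<in> set_pmf (K Center)"
      using leaves[OF C] by blast
    then obtain j where j: "y = End j" "j \<in> {1..n}"
      using step[OF C y(2)] by (auto simp: star_nodes_def)
    then show "0 < pmf (K Center) (End 1)"
      using y(2) unfolding j(1) const(1)[OF j(2), symmetric] by (simp add: pmf_positive_iff)
  next
    obtain y where y: "y \<noteq> End 1" "y \<in> set_pmf (K (End 1))"
      using leaves[OF E[OF one]] by blast
    then have "y = Center"
      using step[OF E[OF one] y(2)] by (auto simp: star_edge_def)
    then show "0 < pmf (K (End 1)) Center"
      using y(2) by (simp add: pmf_positive_iff)
  next
    fix j k assume "j \<in> {1..n}" "k \<in> {1..n}" "j \<noteq> k"
    then show "pmf (K (End j)) (End k) = 0"
      using step[OF E, of j "End k"] by (auto simp: star_edge_def set_pmf_iff)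
  next
    fix x assume "x \<in> star_nodes n"
    then show "set_pmf (K x) \<subseteq> star_nodes n" using step by blast
  qed (use n \<mu> const in blast)+
qed

lemma star_chain_strategy:
  assumes n: "n \<ge> 2" and p: "0 < p" "p \<le> 1 / real n" and s: "0 < s" "s \<le> 1"
  shows "star_chain n p s \<in> patroller_strategies (star_nodes n) (star_edge n)"
proof -
  let ?K = "star_chain n p s"
  let ?r = "{(a, b). a \<in> star_nodes n \<and> b \<in> set_pmf (?K a)}"
  have pmf: "j \<in> {1..n} \<Longrightarrow> pmf (?K Center) (End j) = p" "pmf (?K Center) Center = 1 - real n * p"
    "pmf (?K (End j)) Center = s" "pmf (?K (End j)) (End j) = 1 - s" for j
    using pmf_star_chain[of n p s] assms by (auto simp del: star_chain.simps)
  have "set_pmf (map_pmf End (pmf_of_set {1..n})) = End ` {1..n}"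
    using n by (subst set_map_pmf, subst set_pmf_of_set) auto
  then have supp: "set_pmf (?K Center) \<subseteq> star_nodes n" "set_pmf (?K (End j)) \<subseteq> {Center, End j}" for j
    unfolding star_nodes_def star_chain.simps set_bind_pmf by (auto split: if_splits)
  have step: "y \<in> star_nodes n \<and> (y = x \<or> star_edge n x y)"
    if "x \<in> star_nodes n" "y \<in> set_pmf (?K x)" for x y
  proof (cases x)
    case Center
    then show ?thesis
      using supp(1) that(2) by (auto simp: star_nodes_def star_edge_def simp del: star_chain.simps)
  next
    case (End j)
    then show ?thesis
      using supp(2)[of j] that by (auto simp: star_nodes_def star_edge_def simp del: star_chain.simps)
  qed
  have to: "(x, Center) \<in> ?r\<^sup>*" and from_C: "(Center, x) \<in> ?r\<^sup>*" if "x \<in> star_nodes n" for x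
  proof -
    consider "x = Center" | j where "x = End j" "j \<in> {1..n}"
      using \<open>x \<in> star_nodes n\<close> by (auto simp: star_nodes_def)
    then have "(x, Center) \<in> ?r\<^sup>* \<and> (Center, x) \<in> ?r\<^sup>*"
    proof cases
      case 2
      then have "(x, Center) \<in> ?r" "(Center, x) \<in> ?r"
        using pmf p s \<open>x \<in> star_nodes n\<close>
        by (auto simp del: star_chain.simps simp: star_nodes_def set_pmf_iff)
      then show ?thesis by blast
    qed simp
    then show "(x, Center) \<in> ?r\<^sup>*" "(Center, x) \<in> ?r\<^sup>*" by auto
  qed
  have "irreducible_on (star_nodes n) ?K"
    unfolding irreducible_on_def by (intro ballI rtrancl_trans[OF to from_C])
  moreover have "pmf (?K (f x)) (f y) = pmf (?K x) y"
    if f: "f \<in> network_symmetries (star_nodes n) (star_edge n)"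
      and xy: "x \<in> star_nodes n" "y \<in> star_nodes n" for f x y
  proof -
    obtain \<pi> where \<pi>: "f Center = Center" "inj_on \<pi> {1..n}"
      "\<And>k. k \<in> {1..n} \<Longrightarrow> \<pi> k \<in> {1..n}" "\<And>k. k \<in> {1..n} \<Longrightarrow> f (End k) = End (\<pi> k)"
      using star_symmetryE[OF n f] by blast
    have far: "pmf (?K (End j)) (End k) = 0" if "j \<noteq> k" for j k
      using supp(2)[of j] that by (auto simp del: star_chain.simps simp: set_pmf_iff)
    have inj: "\<pi> j = \<pi> k \<longleftrightarrow> j = k" if "j \<in> {1..n}" "k \<in> {1..n}" for j k
      using inj_on_eq_iff[OF \<pi>(2) that] .
    have "pmf (?K (End (\<pi> j))) (End (\<pi> k)) = pmf (?K (End j)) (End k)"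
      if "j \<in> {1..n}" "k \<in> {1..n}" for j k
      using inj[OF that] pmf(4) far by (cases "j = k") (auto simp del: star_chain.simps)
    then show ?thesis
      using xy \<pi>(1,3,4) pmf unfolding star_nodes_def
      by (auto simp del: star_chain.simps)
  qed
  ultimately show ?thesis
    unfolding patroller_strategies_def mem_Collect_eq by (intro conjI ballI step) simp_all
qed

section \<open>The optimal parameters\<close>

lemma interception_formula_at_optimum:
  fixes n :: real
  assumes "n > 1" "p = 1 - sqrt (n * (n - 1)) / n"
  shows "p * (1 - n * p) / (1 - p) = (2 * n - 1) - 2 * sqrt (n * (n - 1))"
proof -
  define q where "q = sqrt (n * (n - 1))"
  have q: "q > 0" "q * q = n * (n - 1)"
    using assms(1) by (auto simp: q_def)
  have "n * p = n - q"
    using assms by (simp add: q_def field_simps)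
  then have "n * (p * (1 - n * p)) = (n - q) * (1 - n + q)"
    unfolding mult.assoc[symmetric] by simp
  also have "\<dots> = ((2 * n - 1) - 2 * q) * q"
    using q(2) by (simp add: algebra_simps)
  also have "\<dots> = n * (((2 * n - 1) - 2 * q) * (1 - p))"
    using assms by (simp add: q_def)
  finally have "p * (1 - n * p) = ((2 * n - 1) - 2 * q) * (1 - p)"
    using assms(1) by simp
  moreover have "1 - p > 0" using q(1) assms by (simp add: q_def)
  ultimately show ?thesis by (simp add: q_def)
qed

lemma interception_formula_le:
  fixes n :: real
  assumes "n > 1" "p < 1"
  shows "p * (1 - n * p) / (1 - p) \<le> (2 * n - 1) - 2 * sqrt (n * (n - 1))"
proof -
  define q where "q = sqrt (n * (n - 1))"
  have q: "q * q = n * (n - 1)"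
    using assms(1) by (auto simp: q_def)
  \<comment> \<open>The difference is a perfect square because \<open>q\<close> makes the discriminant vanish.\<close>
  have "n * (((2 * n - 1) - 2 * q) * (1 - p) - p * (1 - n * p)) = (n * p - (n - q)) ^ 2"
    using q by (simp add: power2_eq_square algebra_simps)
  then have "0 \<le> n * (((2 * n - 1) - 2 * q) * (1 - p) - p * (1 - n * p))"
    by simp
  then have "p * (1 - n * p) \<le> ((2 * n - 1) - 2 * q) * (1 - p)"
    using assms(1) by (simp add: zero_le_mult_iff)
  then show ?thesis
    using assms(2) by (simp add: q_def divide_le_eq)
qed

theorem proposition1:
  fixes n D :: nat and \<mu> :: "star_node pmf" and r p V :: real
    and K :: "star_node \<Rightarrow> star_node pmf" and A :: "(star_node \<times> nat) pmf"
  assumes "n \<ge> 2" and "D \<ge> 2"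
    and "set_pmf \<mu> \<subseteq> star_nodes n"
  defines "r \<equiv> sqrt (real n * (real n - 1)) - (real n - 1)"
    and "p \<equiv> (1 - r) / real n"
    and "V \<equiv> (2 * real n - 1) - 2 * sqrt (real n * (real n - 1))"
    and "K \<equiv> star_chain n p 1"
    and "A \<equiv> uniform_end_attack n 2"
  shows "p = 1 - sqrt (real n * (real n - 1)) / real n
    \<and> pmf (K Center) Center = r
    \<and> (\<forall>j\<in>{1..n}. pmf (K Center) (End j) = p)
    \<and> patroller_optimal (star_nodes n) (star_edge n) 2 D \<mu> K
    \<and> attacker_optimal (star_nodes n) (star_edge n) 2 D \<mu> A
    \<and> payoff 2 \<mu> K A = V
    \<and> game_value (star_nodes n) (star_edge n) 2 D \<mu> = V"
proof -
  let ?q = "sqrt (real n * (real n - 1))"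
  let ?S = "patroller_strategies (star_nodes n) (star_edge n)"
  have n: "real n > 1" using \<open>n \<ge> 2\<close> by simp
  have p_eq: "p = 1 - ?q / real n"
    using n by (simp add: p_def r_def field_simps)
  have np: "1 - real n * p = r"
    using n by (simp add: p_def)
  have "(real n - 1) * (real n - 1) \<le> real n * (real n - 1)"
    using n by (intro mult_right_mono) auto
  then have "real n - 1 \<le> ?q"
    using n by (intro real_le_rsqrt) (simp add: power2_eq_square)
  moreover have "?q < real n"
  proof -
    have "real n * (real n - 1) < real n * real n"
      using n by (intro mult_strict_left_mono) auto
    then show ?thesis using n by (intro real_less_lsqrt) (auto simp: power2_eq_square)
  qed
  ultimately have p: "0 < p" "p \<le> 1 / real n"
    using n by (auto simp: p_def r_def divide_right_mono)
  have pmf: "pmf (K Center) Center = r" "\<forall>j\<in>{1..n}. pmf (K Center) (End j) = p"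
    "\<And>j. pmf (K (End j)) Center = 1"
    using pmf_star_chain[of n p 1] \<open>n \<ge> 2\<close> p np by (auto simp: K_def simp del: star_chain.simps)
  have K: "K \<in> ?S"
    unfolding K_def using \<open>n \<ge> 2\<close> p by (intro star_chain_strategy) auto
  interpret K: star_patrol n \<mu> K p 1
    using star_patrol_strategy[OF assms(1,3) K] pmf \<open>n \<ge> 2\<close> by simp
  have A_set: "set_pmf A = (\<lambda>j. (End j, 2)) ` {1..n}"
    using \<open>n \<ge> 2\<close> by (simp add: A_def uniform_end_attack_def)
  then have A: "A \<in> attacker_strategies (star_nodes n) D"
    using \<open>D \<ge> 2\<close> by (auto simp: attacker_strategies_def star_nodes_def)
  have value_eq: "p * (1 - real n * p) / (1 - p) = V"
    unfolding V_def using n p_eq by (rule interception_formula_at_optimum)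
  have V_le: "V \<le> 1"
    using K.interception_prob_end_2[of 1] interception_prob_bounds(2)[of 2 \<mu> K "End 1" 2] \<open>n \<ge> 2\<close>
    by (simp add: value_eq)
  have "V \<le> payoff 2 \<mu> K A'" if "A' \<in> attacker_strategies (star_nodes n) D" for A'
  proof (rule payoff_ge)
    fix i d assume "(i, d) \<in> set_pmf A'"
    then have "i \<in> star_nodes n" "d \<ge> 1"
      using that by (auto simp: attacker_strategies_def)
    then show "V \<le> interception_prob 2 \<mu> K i d"
      using K.interception_prob_end_reflecting[of _ d] K.interception_prob_center_reflecting[of d] V_le
      by (auto simp: star_nodes_def value_eq)
  qed
  moreover have "payoff 2 \<mu> K' A \<le> V" if "K' \<in> ?S" for K'
  proof -
    interpret K': star_patrol n \<mu> K' "pmf (K' Center) (End 1)" "pmf (K' (End 1)) Center"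
      using assms(1,3) that by (rule star_patrol_strategy)
    show ?thesis
      unfolding V_def using interception_formula_le[OF n K'.p_less_1]
      by (intro payoff_le) (auto simp: A_set K'.interception_prob_end_2[simplified])
  qed
  ultimately show ?thesis
    using saddle_point[OF K A, of V 2 \<mu>] p_eq pmf(1,2) by blast
qed

end
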